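(* Let $r>0$, $d\ge 1$, and let $\gamma=(\gamma_j)_{j\in\mathbb Z}$, $\alpha=(\alpha_j)_{j\in\mathbb Z}$, $\omega=(\omega_j)_{j\in\mathbb Z}$ be strictly positive symmetric sequences with $\gamma_0=\omega_0=\alpha_0=1$, $\gamma_j\ge 1$ for all $j\in\mathbb Z$, $(\omega_n/\gamma_n)_{n\in\mathbb N_0}$ and $(\alpha_n)_{n\in\mathbb N_0}$ both non-increasing, and $\sum_{j\in\mathbb Z}\alpha_j<\infty$. For $n,m\in\mathbb N$ put $$\Psi_n=\min_{k\in\mathbb N_0}\max\Big\{\frac{\omega_k}{\gamma_k},\sum_{0\le|j|\le k}\frac{\omega_j}{n\alpha_j}\Big\},\qquad k_n^*=\operatorname*{arg\,min}_{k\in\mathbb N_0}\max\Big\{\frac{\omega_k}{\gamma_k},\sum_{0\le|j|\le k}\frac{\omega_j}{n\alpha_j}\Big\},$$ $$\Phi_m=\max_{k\in\mathbb N}\Big\{\frac{\omega_k}{\gamma_k}\min\Big(1,\frac{1}{m\alpha_k}\Big)\Big\}.$$ Then there is a constant $C>0$, not depending on $n$ and $m$, such that for any $n,m\in\mathbb N$ the estimator $\widehat\lambda_{k_n^*}$ (the estimator $\widehat\lambda_k$ defined in the context with $k=k_n^*$) satisfies $$\sup_{\lambda\in\Lambda_\gamma^r}\ \sup_{f\in\mathcal F_\alpha^d}\mathbb E\big[\|\widehat\lambda_{k_n^*}-\lambda\|_\omega^2\big]\ \le\ C\,(\Psi_n+\Phi_m).$$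
   Context: Notation. $\mathbb N=\{1,2,\dots\}$; $\mathbb L^2=\mathbb L^2([0,1),dx)$; $\mathbf e_j(t)=\exp(2\pi i j t)$; for $g\in\mathbb L^2$, $[g]_j=\int_0^1 g(t)\mathbf e_j(-t)\,dt$. A sequence $(a_j)_{j\in\mathbb Z}$ is symmetric if $a_{-j}=a_j$. For a strictly positive symmetric sequence $\omega$, $\|g\|_\omega^2=\sum_{j\in\mathbb Z}\omega_j|[g]_j|^2$. Observation model. $\lambda\in\mathbb L^2$ is a non-negative intensity function and $f\in\mathbb L^2$ a probability density on $[0,1)$, both unknown. Let $\widetilde N_i=\sum_j\delta_{x_{ij}}$, $i=1,\dots,n$, be independent Poisson point processes on $[0,1)$ with intensity function $\lambda$ (with respect to Lebesgue measure), and let $\epsilon_{ij}$ be i.i.d. with density $f$, independent of the $\widetilde N_i$. One observes $N_i=\sum_j\delta_{y_{ij}}$, $i=1,\dots,n$, where $y_{ij}=x_{ij}+\epsilon_{ij}-\lfloor x_{ij}+\epsilon_{ij}\rfloor$, so that $N_1,\dots,N_n$ are i.i.d. Poisson point processes on $[0,1)$ with intensity function the circular convolution $\ell(t)=(\lambda\star f)(t)=\int_0^1\lambda((t-\epsilon)-\lfloor t-\epsilon\rfloor)f(\epsilon)\,d\epsilon$. In addition, one observes an i.i.d. sample $Y_1,\dots,Y_m$ with density $f$, independent of $N_1,\dots,N_n$. $\mathbb E$ denotes expectation under the law of the observations given by $(\lambda,f)$. Estimator. For $k\in\mathbb N_0$, $$\widehat\lambda_k=\sum_{0\le|j|\le k}\frac{\widehat{[\ell]}_j}{\widehat{[f]}_j}\mathbf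 1_{\Omega_j}\mathbf e_j,\quad \widehat{[\ell]}_j=\frac1n\sum_{i=1}^n\int_0^1\mathbf e_j(-t)\,dN_i(t),\quad \widehat{[f]}_j=\frac1m\sum_{i=1}^m\mathbf e_j(-Y_i),\quad \Omega_j=\{|\widehat{[f]}_j|^2\ge1/m\}.$$ Classes. $\Lambda_\gamma^r=\{\lambda\in\mathbb L^2:\lambda\ge0,\ \sum_{j\in\mathbb Z}\gamma_j|[\lambda]_j|^2\le r\}$ and $\mathcal F_\alpha^d=\{f\in\mathbb L^2: f\ge0,\ [f]_0=1,\ d^{-1}\le|[f]_j|^2/\alpha_j\le d\ \text{for all } j\in\mathbb Z\}$. *)

theory Defs
  imports "HOL-Probability.Probability"
begin

section \<open>Fourier analysis on the unit interval\<close>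

abbreviation unit_lebesgue :: "real measure" where
  "unit_lebesgue \<equiv> restrict_space lborel {0..<1}"

text \<open>Functions on [0,1) are total functions on the reals whose values outside [0,1) are ignored;
  equalities and inequalities between elements of L2 are understood almost everywhere.\<close>

definition L2_unit :: "(real \<Rightarrow> 'b :: {banach, second_countable_topology}) set" where
  "L2_unit = {g. g \<in> borel_measurable unit_lebesgue \<and> integrable unit_lebesgue (\<lambda>t. (norm (g t))\<^sup>2)}"

definition basis_e :: "int \<Rightarrow> real \<Rightarrow> complex" where
  "basis_e j t = exp (2 * of_real pi * \<i> * of_int j * of_real t)"

definition fourier_coeff :: "(real \<Rightarrow> complex) \<Rightarrow> int \<Rightarrow> complex" where
  "fourier_coeff g j = (LINT t|unit_lebesgue. g t * basis_e j (- t))"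

text \<open>The squared weighted norm is extended-valued, so that a divergent series is not
  confused with a finite one.\<close>

definition wnorm2 :: "(int \<Rightarrow> real) \<Rightarrow> (real \<Rightarrow> complex) \<Rightarrow> ennreal" where
  "wnorm2 w g = (\<Sum>\<^sub>\<infinity>j. ennreal (w j * (cmod (fourier_coeff g j))\<^sup>2))"

definition symmetric_seq :: "(int \<Rightarrow> real) \<Rightarrow> bool" where
  "symmetric_seq a \<longleftrightarrow> (\<forall>j. a (- j) = a j)"

section \<open>Point processes on the unit interval\<close>

text \<open>As the intensity measures considered here are finite, a point configuration is a finite
  multiset of points; it stands for the sum of the Dirac measures at its elements.\<close>

definition num_points :: "real set \<Rightarrow> real multiset \<Rightarrow> nat" where
  "num_points A N = size (filter_mset (\<lambda>t. t \<in> A) N)"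

definition config_space :: "real multiset measure" where
  "config_space = sigma UNIV {{N. num_points A N = k} | A k. A \<in> sets borel}"

definition poisson_point_process :: "'a measure \<Rightarrow> ('a \<Rightarrow> real multiset) \<Rightarrow> (real \<Rightarrow> real) \<Rightarrow> bool" where
  "poisson_point_process M N lam \<longleftrightarrow>
     N \<in> measurable M config_space \<and>
     (\<forall>x\<in>space M. set_mset (N x) \<subseteq> {0..<1}) \<and>
     (\<forall>A\<in>sets unit_lebesgue. \<forall>k.
        measure M {x\<in>space M. num_points A (N x) = k} =
          (LINT t:A|unit_lebesgue. lam t) ^ k / fact k * exp (- (LINT t:A|unit_lebesgue. lam t))) \<and>
     (\<forall>(I :: nat set) A. finite I \<longrightarrow> (\<forall>i\<in>I. A i \<in> sets unit_lebesgue) \<longrightarrow> disjoint_family_on A I \<longrightarrow>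
        prob_space.indep_vars M (\<lambda>_. count_space UNIV) (\<lambda>i x. num_points (A i) (N x)) I)"

section \<open>Observation model\<close>

text \<open>The library notion of independence of two random variables requires them to take values in the
  same type; this is the version for two different types.\<close>

definition indep_rv ::
  "'a measure \<Rightarrow> 'b measure \<Rightarrow> ('a \<Rightarrow> 'b) \<Rightarrow> 'c measure \<Rightarrow> ('a \<Rightarrow> 'c) \<Rightarrow> bool" where
  "indep_rv M S A T B \<longleftrightarrow> A \<in> measurable M S \<and> B \<in> measurable M T \<and>
     prob_space.indep_set M {A -` E \<inter> space M | E. E \<in> sets S} {B -` E \<inter> space M | E. E \<in> sets T}"

text \<open>The unobserved process of index i has the points X i 0, ..., X i (K i - 1), enumerated in any
  measurable way; the displacements eps are independent of the processes together with these
  enumerations, so that the enumeration cannot anticipate the displacements.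
  The processes are indexed by i < n and the sample Y by i < m.\<close>

definition observation_model ::
  "'a measure \<Rightarrow> nat \<Rightarrow> nat \<Rightarrow> (real \<Rightarrow> real) \<Rightarrow> (real \<Rightarrow> real) \<Rightarrow>
   (nat \<Rightarrow> 'a \<Rightarrow> real multiset) \<Rightarrow> (nat \<Rightarrow> 'a \<Rightarrow> real) \<Rightarrow> bool" where
  "observation_model M n m lam f N Y \<longleftrightarrow> prob_space M \<and>
    (\<exists>(K :: nat \<Rightarrow> 'a \<Rightarrow> nat) (X :: nat \<Rightarrow> nat \<Rightarrow> 'a \<Rightarrow> real) (eps :: nat \<Rightarrow> nat \<Rightarrow> 'a \<Rightarrow> real)
       (hidden :: nat \<Rightarrow> 'a \<Rightarrow> real multiset).
      (\<forall>i<n. \<forall>x\<in>space M. hidden i x = image_mset (\<lambda>j. X i j x) (mset_set {..<K i x})) \<and>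
      (\<forall>i<n. \<forall>x\<in>space M. N i x = image_mset (\<lambda>j. frac (X i j x + eps i j x)) (mset_set {..<K i x})) \<and>
      (\<forall>i<n. poisson_point_process M (hidden i) lam) \<and>
      prob_space.indep_vars M (\<lambda>_. config_space) hidden {..<n} \<and>
      (\<forall>i<n. \<forall>j. distributed M unit_lebesgue (eps i j) (\<lambda>t. ennreal (f t))) \<and>
      prob_space.indep_vars M (\<lambda>_. borel) (\<lambda>(i, j). eps i j) ({..<n} \<times> UNIV) \<and>
      indep_rv M
        (Pi\<^sub>M ({..<n} \<times> UNIV) (\<lambda>_. borel)) (\<lambda>x. \<lambda>(i, j)\<in>{..<n} \<times> UNIV. eps i j x)
        (Pi\<^sub>M {..<n} (\<lambda>_. count_space UNIV) \<Otimes>\<^sub>M Pi\<^sub>M ({..<n} \<times> UNIV) (\<lambda>_. borel))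
        (\<lambda>x. (\<lambda>i\<in>{..<n}. K i x, \<lambda>(i, j)\<in>{..<n} \<times> UNIV. X i j x))) \<and>
    (\<forall>i<m. distributed M unit_lebesgue (Y i) (\<lambda>t. ennreal (f t))) \<and>
    prob_space.indep_vars M (\<lambda>_. borel) Y {..<m} \<and>
    indep_rv M
      (Pi\<^sub>M {..<n} (\<lambda>_. config_space)) (\<lambda>x. \<lambda>i\<in>{..<n}. N i x)
      (Pi\<^sub>M {..<m} (\<lambda>_. borel)) (\<lambda>x. \<lambda>i\<in>{..<m}. Y i x)"

section \<open>Estimator\<close>

definition est_l :: "nat \<Rightarrow> (nat \<Rightarrow> real multiset) \<Rightarrow> int \<Rightarrow> complex" where
  "est_l n N j = (1 / of_nat n) * (\<Sum>i<n. \<Sum>t\<in>#N i. basis_e j (- t))"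

definition est_f :: "nat \<Rightarrow> (nat \<Rightarrow> real) \<Rightarrow> int \<Rightarrow> complex" where
  "est_f m Y j = (1 / of_nat m) * (\<Sum>i<m. basis_e j (- Y i))"

definition est_lambda ::
  "nat \<Rightarrow> nat \<Rightarrow> nat \<Rightarrow> (nat \<Rightarrow> real multiset) \<Rightarrow> (nat \<Rightarrow> real) \<Rightarrow> real \<Rightarrow> complex" where
  "est_lambda n m k N Y t =
     (\<Sum>j\<in>{- int k..int k}.
        est_l n N j / est_f m Y j *
        of_bool ((cmod (est_f m Y j))\<^sup>2 \<ge> 1 / real m) * basis_e j t)"

section \<open>Classes and rates\<close>

definition Lambda_class :: "(int \<Rightarrow> real) \<Rightarrow> real \<Rightarrow> (real \<Rightarrow> real) set" where
  "Lambda_class \<gamma> r =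
     {lam \<in> L2_unit. (AE t in unit_lebesgue. 0 \<le> lam t) \<and>
        wnorm2 \<gamma> (\<lambda>t. complex_of_real (lam t)) \<le> ennreal r}"

definition F_class :: "(int \<Rightarrow> real) \<Rightarrow> real \<Rightarrow> (real \<Rightarrow> real) set" where
  "F_class \<alpha> d =
     {f \<in> L2_unit. (AE t in unit_lebesgue. 0 \<le> f t) \<and>
        fourier_coeff (\<lambda>t. complex_of_real (f t)) 0 = 1 \<and>
        (\<forall>j. 1 / d \<le> (cmod (fourier_coeff (\<lambda>t. complex_of_real (f t)) j))\<^sup>2 / \<alpha> j \<and>
             (cmod (fourier_coeff (\<lambda>t. complex_of_real (f t)) j))\<^sup>2 / \<alpha> j \<le> d)}"

definition rate_objective ::
  "(int \<Rightarrow> real) \<Rightarrow> (int \<Rightarrow> real) \<Rightarrow> (int \<Rightarrow> real) \<Rightarrow> nat \<Rightarrow> nat \<Rightarrow> real" where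
  "rate_objective \<omega> \<gamma> \<alpha> n k =
     max (\<omega> (int k) / \<gamma> (int k)) (\<Sum>j\<in>{- int k..int k}. \<omega> j / (real n * \<alpha> j))"

text \<open>Under the assumptions of the theorem the infimum and the supremum below are attained.\<close>

definition rate_Psi :: "(int \<Rightarrow> real) \<Rightarrow> (int \<Rightarrow> real) \<Rightarrow> (int \<Rightarrow> real) \<Rightarrow> nat \<Rightarrow> real" where
  "rate_Psi \<omega> \<gamma> \<alpha> n = (INF k. rate_objective \<omega> \<gamma> \<alpha> n k)"

definition rate_Phi :: "(int \<Rightarrow> real) \<Rightarrow> (int \<Rightarrow> real) \<Rightarrow> (int \<Rightarrow> real) \<Rightarrow> nat \<Rightarrow> real" where
  "rate_Phi \<omega> \<gamma> \<alpha> m =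
     (SUP k\<in>{1 :: nat..}. \<omega> (int k) / \<gamma> (int k) * min 1 (1 / (real m * \<alpha> (int k))))"

end

theory Submission
  imports Defs
begin

text \<open>Two obstacles shape the proof. The definition of a Poisson process speaks only of counts
  in finitely many sets, so the mean and variance of a character sum are computed for step functions
  and carried through a limit. Dominated convergence keeps the mean; Fatou's lemma keeps the upper
  bound on the variance, which is the direction that a risk bound asks for. The other obstacle is
  the random denominator p. The threshold alone gives 1/|p|^2 <= m, which does not see the true
  coefficient phi. The inequality |phi|^2 <= 2 |p|^2 + 2 D, divided by |p|^2, brings phi in at the
  price of a factor 2 + 2 m D. The squared division error on the event is D/|p|^2, so this price is
  paid on top of a factor D. The resulting m D^2 is the reason why fourth moments of the empirical
  coefficient enter. Conditioning is done by Fubini on the product of two laws: one variable is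
  frozen at a sample point y while the other is integrated over x.\<close>

text \<open>
  Conditionally on the hidden points, the variance of the empirical coefficient of index j comes from
  the displacements alone and is at most the mean number of points divided by n; the remaining
  fluctuation is that of a Poisson functional. Hence its mean squared distance to the product of the
  coefficients of f and lambda is at most 2 L / n, where L is the total intensity. Write D for the
  squared error of the empirical coefficient of f, with true value phi. On the event Omega_j the
  division costs a factor at most (2 + 2 m D) / |phi|^2, and the relative error of the division is
  bounded both by 1 + m D and by (4 D + 2 m D^2 + 2/m) / |phi|^2. Since D and D^2 have means of order
  1/m and 1/m^2, independence of the two samples yields the variance term of order 1 / (n alpha_j) and
  the term of order |[lambda]_j|^2 min(1, 1/(m alpha_j)), which vanishes for j = 0 because the
  coefficient of f of index 0 is known to be 1. Summing with the weights omega_j and using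
  omega_j = (omega_j / gamma_j) gamma_j gives the two rates.
\<close>

section \<open>Independence and moments\<close>

lemma (in prob_space) indep_vars_sum_complex:
  fixes X :: "'i \<Rightarrow> 'a \<Rightarrow> complex"
  assumes I: "finite I" "i \<notin> I" and indep: "indep_vars (\<lambda>_. borel) X (insert i I)"
  shows "indep_var borel (X i) borel (\<lambda>\<omega>. \<Sum>i\<in>I. X i \<omega>)"
proof -
  have "indep_var
    borel ((\<lambda>f. f i) \<circ> (\<lambda>\<omega>. restrict (\<lambda>i. X i \<omega>) {i}))
    borel ((\<lambda>f. \<Sum>i\<in>I. f i) \<circ> (\<lambda>\<omega>. restrict (\<lambda>i. X i \<omega>) I))"
    using I by (intro indep_var_compose[OF indep_var_restrict[OF indep]]) auto
  then show ?thesis by (simp add: comp_def)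
qed

lemma (in prob_space) integrable_of_norm_sq:
  fixes X :: "'a \<Rightarrow> complex"
  assumes X: "random_variable borel X" and sq: "integrable M (\<lambda>x. (cmod (X x))\<^sup>2)"
  shows "integrable M X"
proof (rule integrable_norm_cancel)
  show "integrable M (\<lambda>x. cmod (X x))"
    by (rule square_integrable_imp_integrable[OF measurable_compose[OF X borel_measurable_norm] sq])
qed fact

text \<open>Pythagoras: independent centred summands are orthogonal to each other and to constants.
  The offset \<open>b\<close> allows a deterministic remainder; it will be the error that is left
  once the hidden points are frozen, and with a single summand it yields the variance of a
  character.\<close>

lemma (in prob_space) expectation_norm_sq_sum:
  fixes X :: "'i \<Rightarrow> 'a \<Rightarrow> complex"
  assumes fin: "finite I" and indep: "indep_vars (\<lambda>_. borel) X I"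
    and sq: "\<And>i. i \<in> I \<Longrightarrow> integrable M (\<lambda>x. (cmod (X i x))\<^sup>2)"
    and mean: "\<And>i. i \<in> I \<Longrightarrow> expectation (X i) = 0"
  shows "integrable M (\<lambda>x. (cmod ((\<Sum>i\<in>I. X i x) + b))\<^sup>2)" (is "?int I")
    and "expectation (\<lambda>x. (cmod ((\<Sum>i\<in>I. X i x) + b))\<^sup>2) =
      (\<Sum>i\<in>I. expectation (\<lambda>x. (cmod (X i x))\<^sup>2)) + (cmod b)\<^sup>2" (is "?eq I")
proof -
  have "?int I \<and> ?eq I" using fin indep sq mean
  proof (induction I)
    case empty
    show ?case by (simp add: prob_space)
  next
    case (insert i I)
    let ?S = "\<lambda>x. (\<Sum>i\<in>I. X i x) + b"
    have "indep_vars (\<lambda>_. borel) X I"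
      using insert.prems(1) by (rule indep_vars_subset) auto
    with insert have S: "?int I" "?eq I" by auto
    have rv: "random_variable borel (X j)" if "j \<in> insert i I" for j
      using insert.prems(1) that by (auto simp: indep_vars_def)
    have Smeas: "random_variable borel ?S"
      using rv by measurable
    \<comment> \<open>Conjugation and the shift by \<open>b\<close> are absorbed into a continuous
      function of the partial sum, so that the Hermitian cross term is a product of two independent
      variables.\<close>
    have "indep_var borel ((\<lambda>z. z) \<circ> X i) borel ((\<lambda>z. cnj (z + b)) \<circ> (\<lambda>x. \<Sum>i\<in>I. X i x))"
      using insert by (intro indep_var_compose[OF indep_vars_sum_complex])
        (auto intro!: borel_measurable_continuous_onI continuous_intros)
    then have ind: "indep_var borel (X i) borel (\<lambda>x. cnj (?S x))"
      by (simp add: comp_def)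
    have iX: "integrable M (X i)" by (intro integrable_of_norm_sq rv insert.prems) auto
    have iS: "integrable M (\<lambda>x. cnj (?S x))"
      using integrable_of_norm_sq[OF Smeas S(1)] by (rule integrable_cnj)
    have cross: "integrable M (\<lambda>x. X i x * cnj (?S x))"
      by (rule indep_var_integrable[OF ind iX iS])
    have cross0: "expectation (\<lambda>x. X i x * cnj (?S x)) = 0"
      by (subst indep_var_lebesgue_integral[OF ind iX iS]) (simp add: insert.prems)
    have decomp: "(cmod ((\<Sum>j\<in>insert i I. X j x) + b))\<^sup>2 =
        (cmod (X i x))\<^sup>2 + (cmod (?S x))\<^sup>2 + 2 * Re (X i x * cnj (?S x))" for x
    proof -
      have "(cmod (u + v))\<^sup>2 = (cmod u)\<^sup>2 + (cmod v)\<^sup>2 + 2 * Re (u * cnj v)" for u v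
        unfolding cmod_power2 by (simp add: power2_eq_square algebra_simps)
      from this[of "X i x" "?S x"] show ?thesis using insert.hyps by (simp add: add.assoc)
    qed
    have re: "integrable M (\<lambda>x. Re (X i x * cnj (?S x)))"
      using cross by (rule integrable_Re)
    have re0: "expectation (\<lambda>x. Re (X i x * cnj (?S x))) = 0"
      using integral_Re[OF cross] cross0 by (simp only: zero_complex.sel)
    have iXsq: "integrable M (\<lambda>x. (cmod (X i x))\<^sup>2)" using insert.prems by auto
    note add_int = Bochner_Integration.integrable_add[OF iXsq S(1)]
      integrable_mult_right[OF re, of 2]
    show ?case unfolding decomp unfolding Bochner_Integration.integral_add[OF add_int]
        Bochner_Integration.integral_add[OF iXsq S(1)] integral_mult_right_zero re0 S(2)
        sum.insert[OF insert.hyps]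
      using Bochner_Integration.integrable_add[OF add_int] by (simp only: mult_zero_right add_0_right add.assoc simp_thms)
  qed
  then show "?int I" "?eq I" by auto
qed

text \<open>The growth is m^2 instead of m^4 because every product in which some factor occurs
  exactly once has mean 0. Adding a summand U to the sum S leaves the cross term 6 E[U^2] E[S^2], so
  the induction carries a bound on the second moment along. The bound 2 is the one that centred
  characters satisfy.\<close>

lemma (in prob_space) expectation_fourth_power_sum_le:
  fixes X :: "nat \<Rightarrow> 'a \<Rightarrow> real"
  assumes indep: "indep_vars (\<lambda>_. borel) X {..<m}"
    and bd: "\<And>i x. i < m \<Longrightarrow> x \<in> space M \<Longrightarrow> \<bar>X i x\<bar> \<le> 2"
    and mean: "\<And>i. i < m \<Longrightarrow> expectation (X i) = 0"
  shows "expectation (\<lambda>x. (\<Sum>i<m. X i x) ^ 4) \<le> 48 * real m ^ 2"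
proof -
  have "expectation (\<lambda>x. (\<Sum>i<m. X i x) ^ 2) \<le> 4 * real m \<and>
    expectation (\<lambda>x. (\<Sum>i<m. X i x) ^ 4) \<le> 48 * real m ^ 2"
    using assms
  proof (induction m)
    case 0
    show ?case by simp
  next
    case (Suc m)
    let ?S = "\<lambda>x. \<Sum>i<m. X i x" and ?U = "X m"
    have "indep_vars (\<lambda>_. borel) X {..<m}"
      using Suc.prems(1) by (rule indep_vars_subset) auto
    with Suc have IH: "expectation (\<lambda>x. ?S x ^ 2) \<le> 4 * real m"
      "expectation (\<lambda>x. ?S x ^ 4) \<le> 48 * real m ^ 2" by auto
    have rv: "random_variable borel (X j)" if "j < Suc m" for j
      using Suc.prems(1) that by (auto simp: indep_vars_def)
    then have [measurable]: "random_variable borel ?S" "random_variable borel ?U"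
      by (auto intro!: borel_measurable_sum)
    have Ub: "\<bar>?U x\<bar> \<le> 2" if "x \<in> space M" for x using Suc.prems(2)[of m] that by simp
    have Sb: "\<bar>?S x\<bar> \<le> 2 * real m" if x: "x \<in> space M" for x
    proof -
      have "\<bar>?S x\<bar> \<le> (\<Sum>i<m. \<bar>X i x\<bar>)" by (rule sum_abs)
      also have "\<dots> \<le> (\<Sum>i<m. 2)" using Suc.prems(2) x by (intro sum_mono) auto
      finally show ?thesis by simp
    qed
    have indSU: "indep_var borel ?U borel ?S"
      using indep_vars_sum[of "{..<m}" m X] Suc.prems(1) by (simp add: lessThan_Suc)
    have intU: "integrable M (\<lambda>x. ?U x ^ a)" for a
      by (rule integrable_const_bound[where B="2 ^ a"])
        (use Ub in \<open>auto intro!: AE_I2 simp: power_abs power_mono\<close>)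
    have intS: "integrable M (\<lambda>x. ?S x ^ b)" for b
    proof (rule integrable_const_bound)
      show "AE x in M. norm (?S x ^ b) \<le> (2 * real m) ^ b"
        unfolding real_norm_def power_abs by (intro AE_I2 power_mono Sb) auto
    qed simp
    have ind: "indep_var borel (\<lambda>x. ?U x ^ a) borel (\<lambda>x. ?S x ^ b)" for a b
      using indep_var_compose[OF indSU, of "\<lambda>z. z ^ a" borel "\<lambda>z. z ^ b" borel]
      by (simp add: comp_def)
    have int: "integrable M (\<lambda>x. ?U x ^ a * ?S x ^ b)" for a b
      by (rule indep_var_integrable[OF ind intU intS])
    have prod: "expectation (\<lambda>x. ?U x ^ a * ?S x ^ b) =
        expectation (\<lambda>x. ?U x ^ a) * expectation (\<lambda>x. ?S x ^ b)" for a b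
      by (rule indep_var_lebesgue_integral[OF ind intU intS])
    have U0: "expectation (\<lambda>x. ?U x ^ 1) = 0" using Suc.prems(3)[of m] by simp
    have Upow: "expectation (\<lambda>x. ?U x ^ a) \<le> 2 ^ a" for a
    proof -
      have "expectation (\<lambda>x. ?U x ^ a) \<le> expectation (\<lambda>x. 2 ^ a)"
      proof (intro integral_mono intU)
        fix x assume "x \<in> space M"
        then have "\<bar>?U x\<bar> ^ a \<le> 2 ^ a" by (intro power_mono Ub) auto
        then show "?U x ^ a \<le> 2 ^ a"
          using abs_ge_self[of "?U x ^ a"] unfolding power_abs by linarith
      qed simp
      then show ?thesis by (simp add: prob_space)
    qed
    have ES: "0 \<le> expectation (\<lambda>x. ?S x ^ 2)" by simp
    have EU: "0 \<le> expectation (\<lambda>x. ?U x ^ 2)" by simp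
    have intX: "integrable M (X i)" if "i < m" for i
      using that Suc.prems(2) rv by (intro integrable_const_bound[where B=2] AE_I2) auto
    have S1: "expectation (\<lambda>x. ?S x ^ 1) = 0"
    proof -
      have "expectation ?S = (\<Sum>i<m. expectation (X i))"
        by (rule Bochner_Integration.integral_sum) (use intX in auto)
      also have "\<dots> = 0" using Suc.prems(3) by (intro sum.neutral) auto
      finally show ?thesis by (simp only: power_one_right)
    qed
    \<comment> \<open>The trivial powers are kept so that every term has the shape to which the
      product rule \<open>prod\<close> applies.\<close>
    have sq: "(s + u) ^ 2 = u ^ 0 * s ^ 2 + 2 * (u ^ 1 * s ^ 1) + u ^ 2 * s ^ 0" for s u :: real
      by (simp add: power2_eq_square algebra_simps)
    have four: "(s + u) ^ 4 = u ^ 0 * s ^ 4 + 4 * (u ^ 1 * s ^ 3) + 6 * (u ^ 2 * s ^ 2)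
        + 4 * (u ^ 3 * s ^ 1) + u ^ 4 * s ^ 0" for s u :: real
      by (simp add: power4_eq_xxxx power3_eq_cube power2_eq_square algebra_simps)
    have "(\<Sum>i<Suc m. X i x) ^ 2 = ?U x ^ 0 * ?S x ^ 2 + 2 * (?U x ^ 1 * ?S x ^ 1) + ?U x ^ 2 * ?S x ^ 0" for x
      unfolding sum.lessThan_Suc by (rule sq)
    then have "expectation (\<lambda>x. (\<Sum>i<Suc m. X i x) ^ 2) =
       expectation (\<lambda>x. ?U x ^ 0 * ?S x ^ 2) + 2 * expectation (\<lambda>x. ?U x ^ 1 * ?S x ^ 1)
        + expectation (\<lambda>x. ?U x ^ 2 * ?S x ^ 0)"
      by (simp only: Bochner_Integration.integral_add Bochner_Integration.integrable_add integrable_mult_right int integral_mult_right_zero)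
    also have "\<dots> = expectation (\<lambda>x. ?S x ^ 2) + expectation (\<lambda>x. ?U x ^ 2)"
      unfolding prod U0 by (simp add: prob_space)
    finally have two: "expectation (\<lambda>x. (\<Sum>i<Suc m. X i x) ^ 2) \<le> 4 * real (Suc m)"
      using IH(1) Upow[of 2] by simp
    have "(\<Sum>i<Suc m. X i x) ^ 4 = ?U x ^ 0 * ?S x ^ 4 + 4 * (?U x ^ 1 * ?S x ^ 3)
        + 6 * (?U x ^ 2 * ?S x ^ 2) + 4 * (?U x ^ 3 * ?S x ^ 1) + ?U x ^ 4 * ?S x ^ 0" for x
      unfolding sum.lessThan_Suc by (rule four)
    then have "expectation (\<lambda>x. (\<Sum>i<Suc m. X i x) ^ 4) =
       expectation (\<lambda>x. ?U x ^ 0 * ?S x ^ 4) + 4 * expectation (\<lambda>x. ?U x ^ 1 * ?S x ^ 3)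
        + 6 * expectation (\<lambda>x. ?U x ^ 2 * ?S x ^ 2) + 4 * expectation (\<lambda>x. ?U x ^ 3 * ?S x ^ 1)
        + expectation (\<lambda>x. ?U x ^ 4 * ?S x ^ 0)"
      by (simp only: Bochner_Integration.integral_add Bochner_Integration.integrable_add integrable_mult_right int integral_mult_right_zero)
    also have "\<dots> = expectation (\<lambda>x. ?S x ^ 4) + 6 * (expectation (\<lambda>x. ?U x ^ 2) * expectation (\<lambda>x. ?S x ^ 2))
        + expectation (\<lambda>x. ?U x ^ 4)"
      unfolding prod U0 S1 by (simp add: prob_space)
    \<comment> \<open>Origin of 48: one step adds at most 96 m + 16, while 48 (m+1)^2 exceeds 48 m^2
      by 96 m + 48.\<close>
    also have "\<dots> \<le> 48 * real m ^ 2 + 6 * (4 * (4 * real m)) + 16"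
      using IH Upow[of 2] Upow[of 4] ES EU
      by (intro add_mono mult_mono mult_left_mono) auto
    also have "\<dots> \<le> 48 * real (Suc m) ^ 2"
      by (simp add: power2_eq_square algebra_simps)
    finally show ?case using two by blast
  qed
  then show ?thesis by blast
qed

text \<open>This replaces conditional expectation. By independence the joint law is the product of
  the marginal laws, so \<open>U\<close> can be integrated out first with \<open>V\<close> held at a
  separate sample point \<open>y\<close>. The nonnegative form spares integrability
  conditions.\<close>

lemma indep_rv_nn_integral:
  assumes M: "prob_space M" and ind: "indep_rv M S U T V"
    and g: "g \<in> borel_measurable (S \<Otimes>\<^sub>M T)"
  shows "(\<integral>\<^sup>+x. g (U x, V x) \<partial>M) = (\<integral>\<^sup>+y. \<integral>\<^sup>+x. g (U x, V y) \<partial>M \<partial>M)"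
proof -
  interpret prob_space M by fact
  have U[measurable]: "U \<in> measurable M S" and V[measurable]: "V \<in> measurable M T"
    and I: "indep_set {U -` E \<inter> space M | E. E \<in> sets S} {V -` E \<inter> space M | E. E \<in> sets T}"
    using ind by (auto simp: indep_rv_def)
  interpret S: prob_space "distr M S U" by (rule prob_space_distr) fact
  interpret T: prob_space "distr M T V" by (rule prob_space_distr) fact
  interpret ST: pair_prob_space "distr M S U" "distr M T V" ..
  have law: "distr M S U \<Otimes>\<^sub>M distr M T V = distr M (S \<Otimes>\<^sub>M T) (\<lambda>x. (U x, V x))"
  proof (rule pair_measure_eqI)
    fix A B assume "A \<in> sets (distr M S U)" "B \<in> sets (distr M T V)"
    then have AB[measurable]: "A \<in> sets S" "B \<in> sets T" by auto
    have "prob ((U -` A \<inter> space M) \<inter> (V -` B \<inter> space M)) = prob (U -` A \<inter> space M) * prob (V -` B \<inter> space M)"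
      by (rule indep_setD[OF I]) (use AB in auto)
    moreover have "(\<lambda>x. (U x, V x)) -` (A \<times> B) \<inter> space M = (U -` A \<inter> space M) \<inter> (V -` B \<inter> space M)"
      by auto
    ultimately show "emeasure (distr M S U) A * emeasure (distr M T V) B =
        emeasure (distr M (S \<Otimes>\<^sub>M T) (\<lambda>x. (U x, V x))) (A \<times> B)"
      by (simp add: emeasure_distr emeasure_eq_measure ennreal_mult'')
  qed (auto simp: S.sigma_finite_measure_axioms T.sigma_finite_measure_axioms cong: sets_pair_measure_cong)
  have g'[measurable]: "g \<in> borel_measurable (distr M S U \<Otimes>\<^sub>M distr M T V)"
    using g by (simp cong: measurable_cong_sets sets_pair_measure_cong)
  note [measurable] = g
  have "(\<integral>\<^sup>+x. g (U x, V x) \<partial>M) = (\<integral>\<^sup>+z. g z \<partial>distr M (S \<Otimes>\<^sub>M T) (\<lambda>x. (U x, V x)))"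
    by (subst nn_integral_distr) auto
  also have "\<dots> = (\<integral>\<^sup>+y. \<integral>\<^sup>+x. g (x, y) \<partial>distr M S U \<partial>distr M T V)"
    unfolding law[symmetric] by (rule ST.nn_integral_snd[symmetric, where f=g]) fact
  also have "\<dots> = (\<integral>\<^sup>+y. \<integral>\<^sup>+x. g (x, V y) \<partial>distr M S U \<partial>M)"
    by (subst nn_integral_distr) auto
  also have "\<dots> = (\<integral>\<^sup>+y. \<integral>\<^sup>+x. g (U x, V y) \<partial>M \<partial>M)"
    by (intro nn_integral_cong, subst nn_integral_distr) (auto dest: measurable_space)
  finally show ?thesis .
qed

section \<open>Moments of the Poisson distribution\<close>

lemma (in prob_space) nn_integral_nat_valued:
  fixes X :: "'a \<Rightarrow> nat" and h :: "nat \<Rightarrow> real"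
  assumes X[measurable]: "X \<in> measurable M (count_space UNIV)" and h: "\<And>k. 0 \<le> h k"
  assumes s: "(\<lambda>k. h k * prob {x\<in>space M. X x = k}) sums s"
  shows "(\<integral>\<^sup>+x. ennreal (h (X x)) \<partial>M) = ennreal s"
proof -
  have "(\<integral>\<^sup>+x. ennreal (h (X x)) \<partial>M) =
      (\<integral>\<^sup>+x. (\<Sum>k. ennreal (h k) * indicator {x\<in>space M. X x = k} x) \<partial>M)"
  proof (rule nn_integral_cong)
    fix x assume "x \<in> space M"
    then show "ennreal (h (X x)) = (\<Sum>k. ennreal (h k) * indicator {x\<in>space M. X x = k} x)"
      by (subst suminf_finite[of "{X x}"]) auto
  qed
  also have "\<dots> = (\<Sum>k. ennreal (h k * prob {x\<in>space M. X x = k}))"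
    using h by (subst nn_integral_suminf) (auto simp: nn_integral_cmult emeasure_eq_measure ennreal_mult)
  also have "\<dots> = ennreal s"
    using s h by (intro suminf_ennreal_eq) auto
  finally show ?thesis .
qed

lemma (in prob_space) poisson_moments:
  fixes X :: "'a \<Rightarrow> nat"
  assumes X: "X \<in> measurable M (count_space UNIV)" and \<mu>: "0 \<le> \<mu>"
    and law: "\<And>k. prob {x\<in>space M. X x = k} = \<mu> ^ k / fact k * exp (- \<mu>)"
  shows "integrable M (\<lambda>x. real (X x))" "expectation (\<lambda>x. real (X x)) = \<mu>"
    and "integrable M (\<lambda>x. (real (X x))\<^sup>2)"
    and "expectation (\<lambda>x. (real (X x) - \<mu>)\<^sup>2) = \<mu>"
proof -
  note [measurable] = X
  have e: "(\<lambda>k. \<mu> ^ k / fact k) sums exp \<mu>"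
    using exp_converges[of \<mu>] by (simp add: field_simps scaleR_conv_of_real)
  \<comment> \<open>The moment series are obtained from the exponential series by an index shift:
    the factor k cancels against k!, and the term at k = 0 vanishes.\<close>
  have "(\<lambda>k. \<mu> * (\<mu> ^ k / fact k)) sums (\<mu> * exp \<mu>)" by (rule sums_mult[OF e])
  then have "(\<lambda>k. real (Suc k) * (\<mu> ^ Suc k / fact (Suc k))) sums (\<mu> * exp \<mu>)"
    by (simp add: field_simps del: of_nat_Suc)
  then have s1: "(\<lambda>k. real k * (\<mu> ^ k / fact k)) sums (\<mu> * exp \<mu>)"
    by (subst (asm) sums_Suc_iff) simp
  have "(\<lambda>k. \<mu> * (real k * (\<mu> ^ k / fact k))) sums (\<mu> * (\<mu> * exp \<mu>))" by (rule sums_mult[OF s1])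
  then have "(\<lambda>k. \<mu> * (real k * (\<mu> ^ k / fact k)) + \<mu> * (\<mu> ^ k / fact k)) sums (\<mu> * (\<mu> * exp \<mu>) + \<mu> * exp \<mu>)"
    by (rule sums_add[OF _ sums_mult[OF e]])
  moreover have "\<mu> * (real k * (\<mu> ^ k / fact k)) + \<mu> * (\<mu> ^ k / fact k) =
      (real (Suc k))\<^sup>2 * (\<mu> ^ Suc k / fact (Suc k))" for k
    by (simp add: power2_eq_square divide_simps del: of_nat_Suc) (simp add: algebra_simps)
  ultimately have "(\<lambda>k. (real (Suc k))\<^sup>2 * (\<mu> ^ Suc k / fact (Suc k))) sums (\<mu> * (\<mu> * exp \<mu>) + \<mu> * exp \<mu>)"
    by (simp only:)
  then have s2: "(\<lambda>k. (real k)\<^sup>2 * (\<mu> ^ k / fact k)) sums (\<mu> * (\<mu> * exp \<mu>) + \<mu> * exp \<mu>)"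
    by (subst (asm) sums_Suc_iff) simp
  have "(\<lambda>k. real k * (\<mu> ^ k / fact k) * exp (- \<mu>)) sums (\<mu> * exp \<mu> * exp (- \<mu>))"
    by (rule sums_mult2[OF s1])
  then have n1: "(\<integral>\<^sup>+x. ennreal (real (X x)) \<partial>M) = ennreal \<mu>"
    by (intro nn_integral_nat_valued X) (auto simp: law mult.assoc simp flip: exp_add)
  have "(\<lambda>k. (real k)\<^sup>2 * (\<mu> ^ k / fact k) * exp (- \<mu>)) sums ((\<mu> * (\<mu> * exp \<mu>) + \<mu> * exp \<mu>) * exp (- \<mu>))"
    by (rule sums_mult2[OF s2])
  also have "(\<mu> * (\<mu> * exp \<mu>) + \<mu> * exp \<mu>) * exp (- \<mu>) = \<mu>\<^sup>2 + \<mu>"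
    by (simp add: algebra_simps power2_eq_square flip: exp_add)
  finally have n2: "(\<integral>\<^sup>+x. ennreal ((real (X x))\<^sup>2) \<partial>M) = ennreal (\<mu>\<^sup>2 + \<mu>)"
    by (intro nn_integral_nat_valued X) (auto simp: law mult.assoc)
  show i1: "integrable M (\<lambda>x. real (X x))"
    using n1 by (intro integrableI_nonneg) auto
  show e1: "expectation (\<lambda>x. real (X x)) = \<mu>"
    using n1 \<mu> by (subst integral_eq_nn_integral) auto
  show i2: "integrable M (\<lambda>x. (real (X x))\<^sup>2)"
    using n2 by (intro integrableI_nonneg) auto
  have e2: "expectation (\<lambda>x. (real (X x))\<^sup>2) = \<mu>\<^sup>2 + \<mu>"
    using n2 \<mu> by (subst integral_eq_nn_integral) (auto simp del: ennreal_plus)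
  show "expectation (\<lambda>x. (real (X x) - \<mu>)\<^sup>2) = \<mu>"
    using variance_eq[OF i1 i2] e1 e2 by simp
qed

section \<open>Characters and their sums over point configurations\<close>

lemma norm_basis_e [simp]: "cmod (basis_e j t) = 1"
proof -
  have "basis_e j t = cis (2 * pi * real_of_int j * t)"
    by (simp add: basis_e_def cis_conv_exp mult_ac)
  then show ?thesis by simp
qed

lemma basis_e_add: "basis_e j (s + t) = basis_e j s * basis_e j t"
  by (simp add: basis_e_def ring_distribs exp_add)

lemma basis_e_0 [simp]: "basis_e 0 t = 1"
  by (simp add: basis_e_def)

lemma basis_e_of_int [simp]: "basis_e j (of_int k) = 1"
proof -
  have "basis_e j (of_int k) = exp (of_int (j * k) * (of_real pi * 2 * \<i>))"
    by (simp add: basis_e_def mult_ac)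
  also have "\<dots> = 1" unfolding exp_eq_1 by (auto intro: exI[of _ "j * k"])
  finally show ?thesis .
qed

text \<open>Characters do not see the reduction modulo 1 in the model. Hence the character of a
  displaced point is the product of the characters of the point and of its displacement, which turns
  circular convolution into multiplication.\<close>

lemma basis_e_minus_frac: "basis_e j (- frac t) = basis_e j (- t)"
proof -
  have "- frac t = - t + of_int \<lfloor>t\<rfloor>" by (simp add: frac_def)
  then show ?thesis by (simp only: basis_e_add basis_e_of_int mult_1_right)
qed

lemma continuous_basis_e: "continuous_on UNIV (basis_e j)"
  unfolding basis_e_def by (intro continuous_intros)

lemma measurable_basis_e [measurable]: "basis_e j \<in> borel_measurable borel"
  by (intro borel_measurable_continuous_onI continuous_basis_e)

text \<open>Point counts only see finitely many sets at a time, so character sums over a configuration are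
  approximated by replacing each point t with its left neighbour on a grid of mesh 1/q. Grid points that
  agree modulo 1 have the same character value, so the finitely many sets cell q l cover the whole line.\<close>

definition grid :: "nat \<Rightarrow> real \<Rightarrow> real" where
  "grid q t = of_int \<lfloor>real q * t\<rfloor> / real q"

lemma grid_tendsto: "(\<lambda>q. grid q t) \<longlonglongrightarrow> t"
proof (rule tendsto_sandwich)
  show "\<forall>\<^sub>F q in sequentially. t - 1 / real q \<le> grid q t"
    using eventually_gt_at_top[of 0]
  proof eventually_elim
    case (elim q)
    have "real q * t - 1 \<le> of_int \<lfloor>real q * t\<rfloor>" by linarith
    then have "(real q * t - 1) / real q \<le> grid q t" unfolding grid_def by (rule divide_right_mono) simp
    with elim show ?case by (simp add: diff_divide_distrib)
  qed
  show "\<forall>\<^sub>F q in sequentially. grid q t \<le> t"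
    using eventually_gt_at_top[of 0]
  proof eventually_elim
    case (elim q)
    have "of_int \<lfloor>real q * t\<rfloor> \<le> real q * t" by linarith
    with elim show ?case by (simp add: grid_def field_simps)
  qed
  show "(\<lambda>q. t - 1 / real q) \<longlonglongrightarrow> t"
    using tendsto_diff[OF tendsto_const lim_1_over_n, of t] by simp
qed simp

lemma basis_e_grid_tendsto: "(\<lambda>q. basis_e j (- grid q t)) \<longlonglongrightarrow> basis_e j (- t)"
  using continuous_basis_e[of j] grid_tendsto[of t]
  by (intro isCont_tendsto_compose[of _ "basis_e j"] tendsto_minus) (auto simp: continuous_on_eq_continuous_at)

definition cell :: "nat \<Rightarrow> nat \<Rightarrow> real set" where
  "cell q l = {t. \<lfloor>real q * t\<rfloor> mod int q = int l}"

lemma sets_cell [measurable]: "cell q l \<in> sets borel"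
proof -
  have "cell q l = {t \<in> space borel. (\<lambda>k. k mod int q = int l) \<lfloor>real q * t\<rfloor>}" by (auto simp: cell_def)
  also have "\<dots> \<in> sets borel" by measurable
  finally show ?thesis .
qed

lemma disjoint_cell: "disjoint_family_on (cell q) I"
  by (auto simp: disjoint_family_on_def cell_def)

lemma basis_e_grid:
  assumes "0 < q"
  shows "basis_e j (- grid q t) = (\<Sum>l<q. basis_e j (- (real l / real q)) * indicator (cell q l) t)"
proof -
  define k where "k = \<lfloor>real q * t\<rfloor>"
  define l where "l = nat (k mod int q)"
  have l: "l < q" "k mod int q = int l" using assms by (auto simp: l_def nat_less_iff)
  have ind: "indicator (cell q i) t = (of_bool (i = l) :: complex)" for i
    using l(2) by (auto simp: cell_def k_def[symmetric] indicator_def)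
  have "k = (k div int q) * int q + int l" using l(2) by (metis div_mult_mod_eq)
  then have "real_of_int k = real_of_int (k div int q) * real q + real l"
    by (metis of_int_add of_int_mult of_int_of_nat_eq)
  \<comment> \<open>The grid point and its representative l/q differ by the integer quotient, on
    which the character is 1.\<close>
  then have "- grid q t = - (real l / real q) + of_int (- (k div int q))"
    using assms unfolding grid_def k_def[symmetric] by (simp add: add_divide_distrib)
  then have "basis_e j (- grid q t) = basis_e j (- (real l / real q))"
    by (simp only: basis_e_add basis_e_of_int mult_1_right)
  also have "\<dots> = (\<Sum>i<q. basis_e j (- (real i / real q)) * indicator (cell q i) t)"
    using l(1) by (simp add: ind if_distrib sum.delta of_bool_def cong: if_cong)
  finally show ?thesis .
qed

section \<open>Character sums and their step approximations\<close>

definition char_sum :: "int \<Rightarrow> real multiset \<Rightarrow> complex" where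
  "char_sum j N = (\<Sum>t\<in>#N. basis_e j (- t))"

definition step_char_sum :: "nat \<Rightarrow> int \<Rightarrow> real multiset \<Rightarrow> complex" where
  "step_char_sum q j N = (\<Sum>l<q. basis_e j (- (real l / real q)) * of_nat (num_points (cell q l) N))"

lemma step_char_sum_eq:
  assumes "0 < q"
  shows "step_char_sum q j N = (\<Sum>t\<in>#N. basis_e j (- grid q t))"
proof (induction N)
  case (add t N)
  have "real_of_nat (num_points (cell q l) (add_mset t N)) = indicator (cell q l) t + num_points (cell q l) N" for l
    by (auto simp: num_points_def indicator_def)
  then have "complex_of_nat (num_points (cell q l) (add_mset t N)) = indicator (cell q l) t + of_nat (num_points (cell q l) N)" for l
    by (auto simp: num_points_def indicator_def)
  with add show ?case
    by (simp add: step_char_sum_def basis_e_grid[OF assms] ring_distribs sum.distrib)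
qed (simp add: step_char_sum_def num_points_def)

lemma tendsto_sum_mset:
  fixes g :: "nat \<Rightarrow> 'b \<Rightarrow> complex"
  assumes "\<And>t. (\<lambda>q. g q t) \<longlonglongrightarrow> h t"
  shows "(\<lambda>q. \<Sum>t\<in>#N. g q t) \<longlonglongrightarrow> (\<Sum>t\<in>#N. h t)"
  by (induction N) (auto intro!: tendsto_add assms)

lemma step_char_sum_tendsto: "(\<lambda>q. step_char_sum (Suc q) j N) \<longlonglongrightarrow> char_sum j N"
  unfolding char_sum_def step_char_sum_eq[OF zero_less_Suc]
  by (intro tendsto_sum_mset LIMSEQ_Suc basis_e_grid_tendsto)

lemma norm_sum_mset_le_size:
  fixes g :: "'b \<Rightarrow> complex"
  assumes "\<And>t. cmod (g t) \<le> 1"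
  shows "cmod (\<Sum>t\<in>#N. g t) \<le> real (size N)"
proof (induction N)
  case (add t N)
  then show ?case using norm_triangle_ineq[of "g t" "\<Sum>t\<in>#N. g t"] assms[of t] by simp
qed simp

lemma norm_char_sum_le: "cmod (char_sum j N) \<le> real (size N)"
  unfolding char_sum_def by (rule norm_sum_mset_le_size) simp

lemma norm_step_char_sum_le: "cmod (step_char_sum (Suc q) j N) \<le> real (size N)"
  unfolding step_char_sum_eq[OF zero_less_Suc] by (rule norm_sum_mset_le_size) simp

section \<open>Measurability with respect to point counts\<close>

lemma space_config_space [simp]: "space config_space = UNIV"
  by (simp add: config_space_def space_measure_of_conv)

lemma measurable_num_points [measurable]:
  assumes "A \<in> sets borel"
  shows "num_points A \<in> measurable config_space (count_space UNIV)"
proof (subst measurable_count_space_eq2_countable)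
  have "num_points A -` {k} \<inter> space config_space \<in> sets config_space" for k
  proof -
    have "num_points A -` {k} \<inter> space config_space = {N. num_points A N = k}" by auto
    also have "\<dots> \<in> sets config_space"
      using assms unfolding config_space_def by (subst sets_measure_of) (auto intro!: sigma_sets.Basic)
    finally show ?thesis .
  qed
  then show "num_points A \<in> space config_space \<rightarrow> UNIV \<and>
    (\<forall>a\<in>UNIV. num_points A -` {a} \<inter> space config_space \<in> sets config_space)" by auto
qed

lemma measurable_step_char_sum [measurable]: "step_char_sum q j \<in> borel_measurable config_space"
  unfolding step_char_sum_def by measurable

text \<open>The sigma-algebra on configurations is generated by counts alone. Step sums are
  functions of finitely many counts, and measurability survives their pointwise limit.\<close>

lemma measurable_char_sum [measurable]: "char_sum j \<in> borel_measurable config_space"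
  by (rule borel_measurable_LIMSEQ_metric[OF _ step_char_sum_tendsto]) measurable

lemma prob_space_unit_lebesgue: "prob_space unit_lebesgue"
  by (rule prob_spaceI) (simp add: emeasure_restrict_space space_restrict_space)

lemma borel_unit_lebesgue: "g \<in> borel_measurable borel \<Longrightarrow> g \<in> borel_measurable unit_lebesgue"
  by (simp add: measurable_restrict_space1)

lemma fourier_coeff_of_real_integrable:
  assumes "integrable unit_lebesgue lam"
  shows "integrable unit_lebesgue (\<lambda>t. complex_of_real (lam t) * basis_e j (- t))"
proof (rule Bochner_Integration.integrable_bound[OF assms])
  have [measurable]: "lam \<in> borel_measurable unit_lebesgue" "(\<lambda>t. basis_e j (- t)) \<in> borel_measurable unit_lebesgue"
    using borel_measurable_integrable[OF assms] by (auto intro: borel_unit_lebesgue)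
  show "(\<lambda>t. complex_of_real (lam t) * basis_e j (- t)) \<in> borel_measurable unit_lebesgue"
    by measurable
  show "AE t in unit_lebesgue. norm (complex_of_real (lam t) * basis_e j (- t)) \<le> norm (lam t)"
    by (rule AE_I2) (simp add: norm_mult)
qed

section \<open>Poisson point processes\<close>

lemma sets_unit_lebesgue_Int: "A \<in> sets borel \<Longrightarrow> A \<inter> {0..<1} \<in> sets unit_lebesgue"
  by (auto simp: sets_restrict_space)

lemma poisson_count:
  assumes M: "prob_space M" and P: "poisson_point_process M N lam"
    and int: "integrable unit_lebesgue lam" and nn: "AE t in unit_lebesgue. 0 \<le> lam t"
    and A: "A \<in> sets borel"
  defines "\<mu> \<equiv> (LINT t|unit_lebesgue. indicator A t * lam t)"
  shows "integrable M (\<lambda>x. real (num_points A (N x)))"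
    and "(LINT x|M. real (num_points A (N x))) = \<mu>"
    and "integrable M (\<lambda>x. (real (num_points A (N x)))\<^sup>2)"
    and "(LINT x|M. (real (num_points A (N x)) - \<mu>)\<^sup>2) = \<mu>"
    and "0 \<le> \<mu>"
proof -
  interpret prob_space M by fact
  have N[measurable]: "N \<in> measurable M config_space"
    and sub: "\<And>x. x \<in> space M \<Longrightarrow> set_mset (N x) \<subseteq> {0..<1}"
    and law: "\<And>A k. A \<in> sets unit_lebesgue \<Longrightarrow> prob {x\<in>space M. num_points A (N x) = k} =
          (LINT t:A|unit_lebesgue. lam t) ^ k / fact k * exp (- (LINT t:A|unit_lebesgue. lam t))"
    using P by (auto simp: poisson_point_process_def)
  note [measurable] = A
  have \<mu>: "(LINT t:A \<inter> {0..<1}|unit_lebesgue. lam t) = \<mu>"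
    unfolding \<mu>_def set_lebesgue_integral_def
    by (intro Bochner_Integration.integral_cong) (auto simp: space_restrict_space indicator_def)
  \<comment> \<open>The Poisson law is stated for subsets of the unit interval only; all points lie
    there, so cutting \<open>A\<close> down changes no count.\<close>
  have np: "num_points (A \<inter> {0..<1}) (N x) = num_points A (N x)" if "x \<in> space M" for x
    unfolding num_points_def using sub[OF that]
    by (intro arg_cong[where f=size] filter_mset_cong) auto
  have X: "(\<lambda>x. num_points A (N x)) \<in> measurable M (count_space UNIV)" by measurable
  show \<mu>0: "0 \<le> \<mu>" unfolding \<mu>_def
    using nn by (intro integral_nonneg_AE) (auto elim!: eventually_mono)
  have law': "prob {x\<in>space M. num_points A (N x) = k} = \<mu> ^ k / fact k * exp (- \<mu>)" for k
  proof -
    have "{x\<in>space M. num_points A (N x) = k} = {x\<in>space M. num_points (A \<inter> {0..<1}) (N x) = k}"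
      using np by auto
    then show ?thesis using law[OF sets_unit_lebesgue_Int[OF A], of k] \<mu> by simp
  qed
  note * = poisson_moments[OF X \<mu>0 law']
  show "integrable M (\<lambda>x. real (num_points A (N x)))"
    "(LINT x|M. real (num_points A (N x))) = \<mu>"
    "integrable M (\<lambda>x. (real (num_points A (N x)))\<^sup>2)"
    "(LINT x|M. (real (num_points A (N x)) - \<mu>)\<^sup>2) = \<mu>" by (fact *)+
qed

text \<open>The step sum combines counts of disjoint cells with unimodular weights. These counts are
  independent, and each has its mean as its variance. So the variances add up to the total
  intensity, whatever \<open>j\<close> and the mesh are; this uniformity is what makes the passage
  to the limit possible.\<close>

lemma poisson_step_char_sum:
  fixes j :: int
  assumes M: "prob_space M" and P: "poisson_point_process M N lam"
    and int: "integrable unit_lebesgue lam" and nn: "AE t in unit_lebesgue. 0 \<le> lam t"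
    and q: "0 < q"
  defines "c \<equiv> (LINT t|unit_lebesgue. complex_of_real (lam t) * basis_e j (- grid q t))"
  shows "(LINT x|M. step_char_sum q j (N x)) = c"
    and "(\<integral>\<^sup>+x. ennreal ((cmod (step_char_sum q j (N x) - c))\<^sup>2) \<partial>M) = ennreal (LINT t|unit_lebesgue. lam t)"
proof -
  interpret prob_space M by fact
  have N[measurable]: "N \<in> measurable M config_space"
    and sub: "\<And>x. x \<in> space M \<Longrightarrow> set_mset (N x) \<subseteq> {0..<1}"
    and ind: "\<And>(I :: nat set) A. finite I \<Longrightarrow> (\<forall>i\<in>I. A i \<in> sets unit_lebesgue) \<Longrightarrow> disjoint_family_on A I \<Longrightarrow>
        indep_vars (\<lambda>_. count_space UNIV) (\<lambda>i x. num_points (A i) (N x)) I"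
    using P unfolding poisson_point_process_def by auto
  define \<mu> where "\<mu> l = (LINT t|unit_lebesgue. indicator (cell q l) t * lam t)" for l
  note count = poisson_count[OF M P int nn sets_cell[of q], folded \<mu>_def]
  define e where "e l = basis_e j (- (real l / real q))" for l
  \<comment> \<open>The cells are periodic subsets of the whole line, whereas independence is given
    for subsets of the unit interval; hence the intersection.\<close>
  define Z where "Z l x = e l * (of_nat (num_points (cell q l \<inter> {0..<1}) (N x)) - of_real (\<mu> l))" for l x
  have np: "num_points (A \<inter> {0..<1}) (N x) = num_points A (N x)" if "x \<in> space M" for x A
    unfolding num_points_def using sub[OF that]
    by (intro arg_cong[where f=size] filter_mset_cong) auto
  have il: "integrable unit_lebesgue (\<lambda>t. indicator (cell q l) t * lam t)" for l
  proof (rule Bochner_Integration.integrable_bound[OF int])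
    have [measurable]: "lam \<in> borel_measurable unit_lebesgue" using int by auto
    have [measurable]: "indicat_real (cell q l) \<in> borel_measurable unit_lebesgue"
      by (rule borel_unit_lebesgue) measurable
    show "(\<lambda>t. indicator (cell q l) t * lam t) \<in> borel_measurable unit_lebesgue" by measurable
  qed (auto simp: indicator_def)
  have c: "c = (\<Sum>l<q. e l * of_real (\<mu> l))"
  proof -
    have "c = (LINT t|unit_lebesgue. (\<Sum>l<q. e l * complex_of_real (indicator (cell q l) t * lam t)))"
      unfolding c_def basis_e_grid[OF q] e_def sum_distrib_left
      by (intro Bochner_Integration.integral_cong refl sum.cong) (simp add: indicator_def)
    also have "\<dots> = (\<Sum>l<q. e l * of_real (\<mu> l))"
      unfolding \<mu>_def
      by (subst Bochner_Integration.integral_sum)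
        (intro integrable_mult_right integrable_of_real il, simp only: integral_mult_right_zero integral_complex_of_real)
    finally show ?thesis .
  qed
  have sum_Z: "(\<Sum>l<q. Z l x) = step_char_sum q j (N x) - c" if "x \<in> space M" for x
    unfolding Z_def np[OF that] c step_char_sum_def e_def
    by (simp add: right_diff_distrib sum_subtractf)
  have mu_sum: "(\<Sum>l<q. \<mu> l) = (LINT t|unit_lebesgue. lam t)"
  proof -
    have "(\<Sum>l<q. \<mu> l) = (LINT t|unit_lebesgue. (\<Sum>l<q. indicator (cell q l) t * lam t))"
      unfolding \<mu>_def using il by (subst Bochner_Integration.integral_sum) auto
    also have "\<dots> = (LINT t|unit_lebesgue. lam t)"
    proof (intro Bochner_Integration.integral_cong refl)
      fix t
      \<comment> \<open>For the trivial character, \<open>basis_e_grid\<close> says that the cells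
        partition the line.\<close>
      have "(\<Sum>l<q. indicator (cell q l) t :: real) = 1"
        using arg_cong[OF basis_e_grid[OF q, of 0 t], of Re] by (simp add: indicator_def if_distrib cong: if_cong)
      then show "(\<Sum>l<q. indicator (cell q l) t * lam t) = lam t" by (simp flip: sum_distrib_right)
    qed
    finally show ?thesis .
  qed
  have dis: "disjoint_family_on (\<lambda>l. cell q l \<inter> {0..<1}) {..<q}"
    using disjoint_cell[of q "{..<q}"] by (auto simp: disjoint_family_on_def)
  have indZ: "indep_vars (\<lambda>_. borel) Z {..<q}" unfolding Z_def
    by (rule indep_vars_compose2[OF ind[OF _ _ dis], where Y="\<lambda>l k. e l * (of_nat k - of_real (\<mu> l))"])
      (auto intro: sets_unit_lebesgue_Int)
  have Zsq: "(cmod (Z l x))\<^sup>2 = (real (num_points (cell q l) (N x)) - \<mu> l)\<^sup>2" if "x \<in> space M" for l x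
  proof -
    have "Z l x = e l * of_real (real (num_points (cell q l) (N x)) - \<mu> l)"
      using np[OF that, of "cell q l"] by (simp add: Z_def)
    then have "cmod (Z l x) = \<bar>real (num_points (cell q l) (N x)) - \<mu> l\<bar>"
      by (simp only: norm_mult norm_of_real e_def norm_basis_e mult_1)
    then show ?thesis by simp
  qed
  have int_sq: "integrable M (\<lambda>x. (real (num_points (cell q l) (N x)) - \<mu> l)\<^sup>2)" for l
  proof -
    have "integrable M (\<lambda>x. (real (num_points (cell q l) (N x)))\<^sup>2 + (\<mu> l)\<^sup>2 - 2 * real (num_points (cell q l) (N x)) * \<mu> l)"
      using count(1,3)[of l] by (intro Bochner_Integration.integrable_diff Bochner_Integration.integrable_add) auto
    then show ?thesis by (simp add: power2_diff)
  qed
  have Zint: "integrable M (\<lambda>x. (cmod (Z l x))\<^sup>2)" for l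
    using int_sq[of l] Zsq by (subst Bochner_Integration.integrable_cong[OF refl]) auto
  have Ze: "expectation (\<lambda>x. (cmod (Z l x))\<^sup>2) = \<mu> l" for l
    using count(4)[of l] Zsq by (subst Bochner_Integration.integral_cong[OF refl]) auto
  have EZ: "expectation (Z l) = 0" for l
  proof -
    have "expectation (Z l) = expectation (\<lambda>x. e l * complex_of_real (real (num_points (cell q l) (N x)) - \<mu> l))"
      using np by (intro Bochner_Integration.integral_cong refl) (simp add: Z_def)
    also have "\<dots> = e l * complex_of_real (expectation (\<lambda>x. real (num_points (cell q l) (N x)) - \<mu> l))"
      by (simp only: integral_mult_right_zero integral_complex_of_real)
    also have "\<dots> = 0" using count(1,2)[of l] by (simp add: prob_space)
    finally show ?thesis .
  qed
  note Var = expectation_norm_sq_sum[OF finite_lessThan indZ Zint EZ, of 0]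
  have "(\<integral>\<^sup>+x. ennreal ((cmod (step_char_sum q j (N x) - c))\<^sup>2) \<partial>M) =
      (\<integral>\<^sup>+x. ennreal ((cmod ((\<Sum>l<q. Z l x) + 0))\<^sup>2) \<partial>M)"
    using sum_Z by (intro nn_integral_cong) simp
  also have "\<dots> = ennreal (\<Sum>l<q. \<mu> l)"
    using Var by (subst nn_integral_eq_integral) (auto simp: Ze)
  finally show "(\<integral>\<^sup>+x. ennreal ((cmod (step_char_sum q j (N x) - c))\<^sup>2) \<partial>M) = ennreal (LINT t|unit_lebesgue. lam t)"
    unfolding mu_sum .
  have rv: "random_variable borel (Z l)" if "l < q" for l
    using indZ that by (auto simp: indep_vars_def)
  have iZ: "integrable M (Z l)" if "l < q" for l by (rule integrable_of_norm_sq[OF rv[OF that] Zint])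
  have "expectation (\<lambda>x. step_char_sum q j (N x)) = expectation (\<lambda>x. (\<Sum>l<q. Z l x) + c)"
    using sum_Z by (intro Bochner_Integration.integral_cong refl) simp
  also have "\<dots> = expectation (\<lambda>x. \<Sum>l<q. Z l x) + c"
    using iZ by (subst Bochner_Integration.integral_add) (auto simp: prob_space)
  also have "expectation (\<lambda>x. \<Sum>l<q. Z l x) = 0"
    using iZ EZ by (subst Bochner_Integration.integral_sum) auto
  finally show "expectation (\<lambda>x. step_char_sum q j (N x)) = c" by simp
qed

text \<open>The mesh tends to 0. The number of points dominates all step sums, which gives the mean
  by dominated convergence; its finite second moment gives square integrability; the variance bound
  passes by Fatou's lemma.\<close>

lemma poisson_char_sum:
  fixes j :: int
  assumes M: "prob_space M" and P: "poisson_point_process M N lam"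
    and int: "integrable unit_lebesgue lam" and nn: "AE t in unit_lebesgue. 0 \<le> lam t"
  defines "c \<equiv> fourier_coeff (\<lambda>t. complex_of_real (lam t)) j"
  shows "(\<integral>\<^sup>+x. ennreal (real (size (N x))) \<partial>M) = ennreal (LINT t|unit_lebesgue. lam t)"
    and "integrable M (\<lambda>x. (cmod (char_sum j (N x)))\<^sup>2)"
    and "(LINT x|M. char_sum j (N x)) = c"
    and "(\<integral>\<^sup>+x. ennreal ((cmod (char_sum j (N x) - c))\<^sup>2) \<partial>M) \<le> ennreal (LINT t|unit_lebesgue. lam t)"
proof -
  interpret prob_space M by fact
  have N[measurable]: "N \<in> measurable M config_space"
    and sub: "\<And>x. x \<in> space M \<Longrightarrow> set_mset (N x) \<subseteq> {0..<1}"
    using P unfolding poisson_point_process_def by auto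
  have sz: "num_points UNIV (N x) = size (N x)" for x by (simp add: num_points_def)
  have UNIV_borel: "(UNIV :: real set) \<in> sets borel" by simp
  note count = poisson_count[OF M P int nn UNIV_borel, unfolded sz, simplified]
  show "(\<integral>\<^sup>+x. ennreal (real (size (N x))) \<partial>M) = ennreal (LINT t|unit_lebesgue. lam t)"
    using count(1,2) by (subst nn_integral_eq_integral) auto
  define C where "C q = (LINT t|unit_lebesgue. complex_of_real (lam t) * basis_e j (- grid (Suc q) t))" for q
  note step = poisson_step_char_sum[OF M P int nn zero_less_Suc, where j=j, folded C_def]
  have lm[measurable]: "lam \<in> borel_measurable unit_lebesgue" using int by auto
  have [measurable]: "(\<lambda>t. basis_e j (- grid (Suc q) t)) \<in> borel_measurable unit_lebesgue" for q
    unfolding grid_def by (rule borel_unit_lebesgue) measurable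
  have [measurable]: "(\<lambda>t. basis_e j (- t)) \<in> borel_measurable unit_lebesgue"
    by (rule borel_unit_lebesgue) measurable
  have C: "C \<longlonglongrightarrow> c" unfolding C_def c_def fourier_coeff_def
  proof (rule integral_dominated_convergence[where w="\<lambda>t. \<bar>lam t\<bar>"])
    show "AE t in unit_lebesgue. (\<lambda>q. complex_of_real (lam t) * basis_e j (- grid (Suc q) t))
        \<longlonglongrightarrow> complex_of_real (lam t) * basis_e j (- t)"
      by (intro AE_I2 tendsto_mult tendsto_const LIMSEQ_Suc basis_e_grid_tendsto)
  next
    fix q show "AE t in unit_lebesgue. norm (complex_of_real (lam t) * basis_e j (- grid (Suc q) t)) \<le> \<bar>lam t\<bar>"
      by (rule AE_I2) (simp add: norm_mult)
  next
    show "integrable unit_lebesgue (\<lambda>t. \<bar>lam t\<bar>)" using int by (rule integrable_abs)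
  qed measurable
  have ms[measurable]: "(\<lambda>x. step_char_sum q j (N x)) \<in> borel_measurable M"
    "(\<lambda>x. char_sum j (N x)) \<in> borel_measurable M" for q
    by (rule measurable_compose[OF N]; measurable)+
  have "(\<lambda>q. expectation (\<lambda>x. step_char_sum (Suc q) j (N x))) \<longlonglongrightarrow> expectation (\<lambda>x. char_sum j (N x))"
  proof (rule integral_dominated_convergence[where w="\<lambda>x. real (size (N x))"])
    show "AE x in M. (\<lambda>q. step_char_sum (Suc q) j (N x)) \<longlonglongrightarrow> char_sum j (N x)"
      by (intro AE_I2 step_char_sum_tendsto)
  next
    fix q show "AE x in M. norm (step_char_sum (Suc q) j (N x)) \<le> real (size (N x))"
      by (intro AE_I2 norm_step_char_sum_le)
  qed (use ms count in auto)
  then have "C \<longlonglongrightarrow> expectation (\<lambda>x. char_sum j (N x))" by (simp only: step(1))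
  then show "expectation (\<lambda>x. char_sum j (N x)) = c" using C by (rule LIMSEQ_unique)
  show "integrable M (\<lambda>x. (cmod (char_sum j (N x)))\<^sup>2)"
  proof (rule Bochner_Integration.integrable_bound[OF count(3)])
    show "AE x in M. norm ((cmod (char_sum j (N x)))\<^sup>2) \<le> norm ((real (size (N x)))\<^sup>2)"
      using norm_char_sum_le by (intro AE_I2) (simp add: power_mono)
  qed measurable
  have "(\<integral>\<^sup>+x. ennreal ((cmod (char_sum j (N x) - c))\<^sup>2) \<partial>M) =
      (\<integral>\<^sup>+x. liminf (\<lambda>q. ennreal ((cmod (step_char_sum (Suc q) j (N x) - C q))\<^sup>2)) \<partial>M)"
  proof (intro nn_integral_cong lim_imp_Liminf[symmetric] tendsto_ennrealI)
    fix x show "(\<lambda>q. (cmod (step_char_sum (Suc q) j (N x) - C q))\<^sup>2) \<longlonglongrightarrow> (cmod (char_sum j (N x) - c))\<^sup>2"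
      by (intro tendsto_power tendsto_norm tendsto_diff C step_char_sum_tendsto)
  qed simp
  also have "\<dots> \<le> liminf (\<lambda>q. \<integral>\<^sup>+x. ennreal ((cmod (step_char_sum (Suc q) j (N x) - C q))\<^sup>2) \<partial>M)"
    by (intro nn_integral_liminf) measurable
  also have "\<dots> = ennreal (LINT t|unit_lebesgue. lam t)"
    unfolding step(2) by (simp add: Liminf_const)
  finally show "(\<integral>\<^sup>+x. ennreal ((cmod (char_sum j (N x) - c))\<^sup>2) \<partial>M) \<le> ennreal (LINT t|unit_lebesgue. lam t)" .
qed

section \<open>The empirical coefficients\<close>

lemma distributed_basis_e:
  assumes M: "prob_space M" and X: "distributed M unit_lebesgue X (\<lambda>t. ennreal (f t))"
    and f: "f \<in> borel_measurable unit_lebesgue" "AE t in unit_lebesgue. 0 \<le> f t"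
  shows "(LINT x|M. basis_e j (- X x)) = fourier_coeff (\<lambda>t. complex_of_real (f t)) j"
proof -
  have g: "(\<lambda>t. basis_e j (- t)) \<in> borel_measurable unit_lebesgue"
    by (rule borel_unit_lebesgue) measurable
  have X': "X \<in> measurable M unit_lebesgue" and law: "distr M unit_lebesgue X = density unit_lebesgue (\<lambda>t. ennreal (f t))"
    using X by (auto simp: distributed_def)
  have "(LINT x|M. basis_e j (- X x)) = integral\<^sup>L (distr M unit_lebesgue X) (\<lambda>t. basis_e j (- t))"
    by (rule integral_distr[OF X' g, symmetric])
  also have "\<dots> = (LINT t|unit_lebesgue. f t *\<^sub>R basis_e j (- t))"
    unfolding law by (rule integral_density[OF g f])
  finally show ?thesis by (simp add: fourier_coeff_def scaleR_conv_of_real)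
qed

text \<open>A character has modulus 1, so its second moment is 1 and the variance is what
  \<open>\<phi>\<close> leaves of it. That |\<phi>| is at most 1 then follows because a variance is
  nonnegative.\<close>

lemma (in prob_space) expectation_basis_e_centred:
  assumes X: "random_variable borel X" and \<phi>: "expectation (\<lambda>x. basis_e j (- X x)) = \<phi>"
  shows "integrable M (\<lambda>x. (cmod (basis_e j (- X x) - \<phi>))\<^sup>2)"
    and "expectation (\<lambda>x. basis_e j (- X x) - \<phi>) = 0"
    and "expectation (\<lambda>x. (cmod (basis_e j (- X x) - \<phi>))\<^sup>2) = 1 - (cmod \<phi>)\<^sup>2"
    and "cmod \<phi> \<le> 1"
proof -
  note [measurable] = X
  have i: "integrable M (\<lambda>x. basis_e j (- X x))"
    by (rule integrable_const_bound[where B=1]) (auto simp: measurable_compose[OF X])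
  show 2: "expectation (\<lambda>x. basis_e j (- X x) - \<phi>) = 0"
    using i \<phi> by (simp add: prob_space)
  have "cmod (basis_e j (- X x) - \<phi>) \<le> 1 + cmod \<phi>" for x
    using norm_triangle_ineq4[of "basis_e j (- X x)" \<phi>] by simp
  then show 1: "integrable M (\<lambda>x. (cmod (basis_e j (- X x) - \<phi>))\<^sup>2)"
    by (intro integrable_const_bound[where B="(1 + cmod \<phi>)\<^sup>2"] AE_I2) (auto intro!: power_mono)
  \<comment> \<open>A family with one member is independent, so Pythagoras applies with offset
    \<open>\<phi>\<close>.\<close>
  have ind: "indep_vars (\<lambda>_. borel) (\<lambda>(_ :: unit) x. basis_e j (- X x) - \<phi>) {()}"
    unfolding indep_vars_def2 indep_sets_def by (auto simp: subset_singleton_iff)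
  have "expectation (\<lambda>x. (cmod ((\<Sum>i\<in>{()}. basis_e j (- X x) - \<phi>) + \<phi>))\<^sup>2) =
     (\<Sum>i\<in>{()}. expectation (\<lambda>x. (cmod (basis_e j (- X x) - \<phi>))\<^sup>2)) + (cmod \<phi>)\<^sup>2"
    by (rule expectation_norm_sq_sum(2)[OF _ ind 1 2]) simp
  then show 3: "expectation (\<lambda>x. (cmod (basis_e j (- X x) - \<phi>))\<^sup>2) = 1 - (cmod \<phi>)\<^sup>2"
    by (simp add: prob_space)
  have "0 \<le> 1 - (cmod \<phi>)\<^sup>2" unfolding 3[symmetric] by simp
  then show "cmod \<phi> \<le> 1" by (simp add: power2_le_iff_abs_le abs_square_le_1)
qed

text \<open>\<open>D\<close> is the squared modulus of a mean of m independent centred terms bounded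
  by 2, hence of order 1/m. Its square is a fourth power, which is treated through real and
  imaginary parts: each is a sum of independent centred real variables with the same bound
  2.\<close>

lemma est_f_moments:
  fixes j :: int
  assumes M: "prob_space M" and m: "1 \<le> m"
    and Y: "\<And>i. i < m \<Longrightarrow> distributed M unit_lebesgue (Y i) (\<lambda>t. ennreal (f t))"
    and ind: "prob_space.indep_vars M (\<lambda>_. borel) Y {..<m}"
    and f: "f \<in> borel_measurable unit_lebesgue" "AE t in unit_lebesgue. 0 \<le> f t"
  defines "D \<equiv> (\<lambda>x. (cmod (est_f m (\<lambda>i. Y i x) j - fourier_coeff (\<lambda>t. complex_of_real (f t)) j))\<^sup>2)"
  shows "integrable M D" "integrable M (\<lambda>x. (D x)\<^sup>2)"
    and "(LINT x|M. D x) \<le> 1 / real m" and "(LINT x|M. (D x)\<^sup>2) \<le> 192 / (real m)\<^sup>2"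
proof -
  interpret prob_space M by fact
  define \<phi> where "\<phi> = fourier_coeff (\<lambda>t. complex_of_real (f t)) j"
  define Z where "Z i x = basis_e j (- Y i x) - \<phi>" for i x
  have rvY[measurable]: "random_variable borel (Y i)" if "i < m" for i
    using ind that by (auto simp: indep_vars_def)
  note Zc = expectation_basis_e_centred[OF rvY distributed_basis_e[OF M Y f, of _ j, folded \<phi>_def], folded Z_def]
  have indZ: "indep_vars (\<lambda>_. borel) Z {..<m}" unfolding Z_def
    by (rule indep_vars_compose2[OF ind]) measurable
  have rvZ: "random_variable borel (Z i)" if "i < m" for i
    using indZ that by (auto simp: indep_vars_def)
  have Zb: "cmod (Z i x) \<le> 2" if "i < m" for i x
    using norm_triangle_ineq4[of "basis_e j (- Y i x)" \<phi>] Zc(4)[OF that that] by (simp add: Z_def)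
  have iZ: "integrable M (Z i)" if "i < m" for i
    by (rule integrable_of_norm_sq[OF rvZ[OF that] Zc(1)[OF that that]])
  have D: "D x = (cmod (\<Sum>i<m. Z i x))\<^sup>2 / (real m)\<^sup>2" for x
  proof -
    have "est_f m (\<lambda>i. Y i x) j - \<phi> = (\<Sum>i<m. Z i x) / of_nat m"
      using m by (simp add: est_f_def Z_def sum_subtractf field_simps)
    then show ?thesis by (simp add: D_def \<phi>_def[symmetric] norm_divide power_divide)
  qed
  have var: "integrable M (\<lambda>x. (cmod (\<Sum>i<m. Z i x))\<^sup>2)"
    "expectation (\<lambda>x. (cmod (\<Sum>i<m. Z i x))\<^sup>2) = (\<Sum>i<m. expectation (\<lambda>x. (cmod (Z i x))\<^sup>2))"
    using expectation_norm_sq_sum[OF finite_lessThan indZ, of 0] Zc(1,2) by auto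
  show "integrable M D" unfolding D using var(1) by simp
  have "expectation (\<lambda>x. (cmod (\<Sum>i<m. Z i x))\<^sup>2) \<le> (\<Sum>i<m. 1)"
    unfolding var(2) using Zc(3) by (intro sum_mono) auto
  then have "expectation D \<le> real m / (real m)\<^sup>2" unfolding D by (simp add: divide_right_mono)
  then show "expectation D \<le> 1 / real m" using m by (simp add: power2_eq_square split: if_splits)
  have indRe: "indep_vars (\<lambda>_. borel) (\<lambda>i x. Re (Z i x)) {..<m}"
    by (rule indep_vars_compose2[OF indZ]) measurable
  have indIm: "indep_vars (\<lambda>_. borel) (\<lambda>i x. Im (Z i x)) {..<m}"
    by (rule indep_vars_compose2[OF indZ]) measurable
  have re4: "expectation (\<lambda>x. (\<Sum>i<m. Re (Z i x)) ^ 4) \<le> 48 * real m ^ 2"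
    using Zb Zc(2) by (intro expectation_fourth_power_sum_le indRe)
      (auto intro: order_trans[OF abs_Re_le_cmod] simp: integral_Re[OF iZ])
  have im4: "expectation (\<lambda>x. (\<Sum>i<m. Im (Z i x)) ^ 4) \<le> 48 * real m ^ 2"
    using Zb Zc(2) by (intro expectation_fourth_power_sum_le indIm)
      (auto intro: order_trans[OF abs_Im_le_cmod] simp: integral_Im[OF iZ])
  have Sb: "cmod (\<Sum>i<m. Z i x) \<le> 2 * real m" for x
    using order_trans[OF norm_sum sum_mono[of "{..<m}" "\<lambda>i. cmod (Z i x)" "\<lambda>_. 2"]] Zb by simp
  have Rb: "\<bar>\<Sum>i<m. Re (Z i x)\<bar> ^ 4 \<le> (2 * real m) ^ 4" for x
    using order_trans[OF abs_Re_le_cmod Sb[of x]] by (intro power_mono) auto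
  have Ib: "\<bar>\<Sum>i<m. Im (Z i x)\<bar> ^ 4 \<le> (2 * real m) ^ 4" for x
    using order_trans[OF abs_Im_le_cmod Sb[of x]] by (intro power_mono) auto
  have rvRe: "random_variable borel (\<lambda>x. \<Sum>i<m. Re (Z i x))"
    using indRe by (intro borel_measurable_sum) (auto simp: indep_vars_def)
  have rvIm: "random_variable borel (\<lambda>x. \<Sum>i<m. Im (Z i x))"
    using indIm by (intro borel_measurable_sum) (auto simp: indep_vars_def)
  have iR: "integrable M (\<lambda>x. (\<Sum>i<m. Re (Z i x)) ^ 4)"
    by (rule integrable_const_bound[where B="(2 * real m) ^ 4"])
      (use Rb rvRe in \<open>auto simp only: real_norm_def power_abs intro!: AE_I2 borel_measurable_power\<close>)
  have iI: "integrable M (\<lambda>x. (\<Sum>i<m. Im (Z i x)) ^ 4)"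
    by (rule integrable_const_bound[where B="(2 * real m) ^ 4"])
      (use Ib rvIm in \<open>auto simp only: real_norm_def power_abs intro!: AE_I2 borel_measurable_power\<close>)
  have D2: "(D x)\<^sup>2 \<le> (2 * (\<Sum>i<m. Re (Z i x)) ^ 4 + 2 * (\<Sum>i<m. Im (Z i x)) ^ 4) / real m ^ 4" for x
  proof -
    have "(a\<^sup>2 + b\<^sup>2)\<^sup>2 \<le> 2 * a ^ 4 + 2 * b ^ 4" for a b :: real
      using sum_squares_bound[of "a\<^sup>2" "b\<^sup>2"] by (simp add: power2_sum flip: power_mult)
    then have "((cmod (\<Sum>i<m. Z i x))\<^sup>2)\<^sup>2 \<le> 2 * (\<Sum>i<m. Re (Z i x)) ^ 4 + 2 * (\<Sum>i<m. Im (Z i x)) ^ 4"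
      by (simp add: cmod_power2)
    moreover have "(D x)\<^sup>2 = ((cmod (\<Sum>i<m. Z i x))\<^sup>2)\<^sup>2 / real m ^ 4"
      by (simp add: D power_divide flip: power_mult)
    ultimately show ?thesis by (simp add: divide_right_mono)
  qed
  have iB: "integrable M (\<lambda>x. (2 * (\<Sum>i<m. Re (Z i x)) ^ 4 + 2 * (\<Sum>i<m. Im (Z i x)) ^ 4) / real m ^ 4)"
    using iR iI by (intro integrable_divide Bochner_Integration.integrable_add integrable_mult_right) auto
  have "random_variable borel D" using \<open>integrable M D\<close> by auto
  then show iD2: "integrable M (\<lambda>x. (D x)\<^sup>2)"
    using D2 by (intro Bochner_Integration.integrable_bound[OF iB] AE_I2)
      (auto intro: order_trans[OF _ abs_ge_self])
  have "expectation (\<lambda>x. (D x)\<^sup>2) \<le>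
      expectation (\<lambda>x. (2 * (\<Sum>i<m. Re (Z i x)) ^ 4 + 2 * (\<Sum>i<m. Im (Z i x)) ^ 4) / real m ^ 4)"
    by (intro integral_mono iD2 iB D2)
  also have "\<dots> = (2 * expectation (\<lambda>x. (\<Sum>i<m. Re (Z i x)) ^ 4) + 2 * expectation (\<lambda>x. (\<Sum>i<m. Im (Z i x)) ^ 4)) / real m ^ 4"
    using iR iI by simp
  \<comment> \<open>The constant 192 is 2 * 48 for the real part plus 2 * 48 for the imaginary part;
    the factors 2 come from (a^2 + b^2)^2 <= 2 a^4 + 2 b^4.\<close>
  also have "\<dots> \<le> (2 * (48 * real m ^ 2) + 2 * (48 * real m ^ 2)) / real m ^ 4"
    using re4 im4 by (intro divide_right_mono add_mono mult_left_mono) auto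
  also have "\<dots> = 192 / (real m)\<^sup>2"
    using m by (simp add: field_simps power2_eq_square power4_eq_xxxx)
  finally show "expectation (\<lambda>x. (D x)\<^sup>2) \<le> 192 / (real m)\<^sup>2" .
qed

lemma est_l_eq_char_sum: "est_l n N j = (\<Sum>i<n. char_sum j (N i)) / of_nat n"
  by (simp add: est_l_def char_sum_def)

text \<open>The factor 2 counts two fluctuations of size at most \<Lambda>/n: the displacements
  around their mean given the hidden points, and the hidden points around their intensity. Given the
  hidden points the second is a constant, so the two are orthogonal and their squares add without a
  cross term.\<close>

lemma est_l_risk:
  fixes j :: int
  assumes om: "observation_model M n m lam f N Y" and n: "1 \<le> n"
    and lam: "integrable unit_lebesgue lam" "AE t in unit_lebesgue. 0 \<le> lam t"
    and f: "f \<in> borel_measurable unit_lebesgue" "AE t in unit_lebesgue. 0 \<le> f t"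
  defines "\<phi> \<equiv> fourier_coeff (\<lambda>t. complex_of_real (f t)) j"
    and "a \<equiv> fourier_coeff (\<lambda>t. complex_of_real (lam t)) j"
  shows "(\<integral>\<^sup>+x. ennreal ((cmod (est_l n (\<lambda>i. N i x) j - \<phi> * a))\<^sup>2) \<partial>M)
    \<le> ennreal (2 * (LINT t|unit_lebesgue. lam t) / real n)"
proof -
  define \<Lambda> where "\<Lambda> = (LINT t|unit_lebesgue. lam t)"
  have \<Lambda>0: "0 \<le> \<Lambda>" unfolding \<Lambda>_def using lam(2) by (intro integral_nonneg_AE)
  \<comment> \<open>The index set is infinite because the numbers of points are random; a finite
    index set arises only once the hidden data are frozen.\<close>
  define J where "J = {..<n} \<times> (UNIV :: nat set)"
  obtain K X eps hidden where M: "prob_space M"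
    and hid': "\<forall>i<n. \<forall>x\<in>space M. hidden i x = image_mset (\<lambda>k. X i k x) (mset_set {..<K i x})"
    and N': "\<forall>i<n. \<forall>x\<in>space M. N i x = image_mset (\<lambda>k. frac (X i k x + eps i k x)) (mset_set {..<K i x})"
    and pp': "\<forall>i<n. poisson_point_process M (hidden i) lam"
    and ind_hid: "prob_space.indep_vars M (\<lambda>_. config_space) hidden {..<n}"
    and eps': "\<forall>i<n. \<forall>k. distributed M unit_lebesgue (eps i k) (\<lambda>t. ennreal (f t))"
    and ind_eps: "prob_space.indep_vars M (\<lambda>_. borel) (\<lambda>(i, k). eps i k) J"
    and indep: "indep_rv M (Pi\<^sub>M J (\<lambda>_. borel)) (\<lambda>x. \<lambda>(i, k)\<in>J. eps i k x)
        (Pi\<^sub>M {..<n} (\<lambda>_. count_space UNIV) \<Otimes>\<^sub>M Pi\<^sub>M J (\<lambda>_. borel))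
        (\<lambda>x. (\<lambda>i\<in>{..<n}. K i x, \<lambda>(i, k)\<in>J. X i k x))"
    using om unfolding observation_model_def J_def[symmetric]
    by (elim conjE exE) (rule that; assumption)
  note hid = hid'[rule_format] and N = N'[rule_format] and pp = pp'[rule_format] and eps = eps'[rule_format]
  interpret prob_space M by fact
  define g :: "(nat \<times> nat \<Rightarrow> real) \<times> (nat \<Rightarrow> nat) \<times> (nat \<times> nat \<Rightarrow> real) \<Rightarrow> complex" where
    "g z = (\<Sum>i<n. \<Sum>k<fst (snd z) i. basis_e j (- snd (snd z) (i, k)) * basis_e j (- fst z (i, k))) / of_nat n" for z
  let ?S = "Pi\<^sub>M J (\<lambda>_. borel :: real measure)"
  let ?T = "Pi\<^sub>M {..<n} (\<lambda>_. count_space (UNIV :: nat set)) \<Otimes>\<^sub>M Pi\<^sub>M J (\<lambda>_. borel :: real measure)"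
  have g[measurable]: "g \<in> borel_measurable (?S \<Otimes>\<^sub>M ?T)"
  proof -
    have "(\<lambda>z. \<Sum>k<fst (snd z) i. basis_e j (- snd (snd z) (i, k)) * basis_e j (- fst z (i, k)))
        \<in> borel_measurable (?S \<Otimes>\<^sub>M ?T)" if i: "i < n" for i
    \<comment> \<open>The upper limit of the inner sum is itself a coordinate, so measurability is
      proved for each of its countably many values.\<close>
    proof (rule measurable_compose_countable[where g="\<lambda>z. fst (snd z) i"])
      have [measurable]: "(\<lambda>z. fst z (i, k)) \<in> borel_measurable (?S \<Otimes>\<^sub>M ?T)"
        "(\<lambda>z. snd (snd z) (i, k)) \<in> borel_measurable (?S \<Otimes>\<^sub>M ?T)" for k
        using i by (auto intro!: measurable_compose[OF _ measurable_component_singleton] simp: J_def)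
      show "(\<lambda>z. \<Sum>k<l. basis_e j (- snd (snd z) (i, k)) * basis_e j (- fst z (i, k)))
        \<in> borel_measurable (?S \<Otimes>\<^sub>M ?T)" for l by measurable
      show "(\<lambda>z. fst (snd z) i) \<in> measurable (?S \<Otimes>\<^sub>M ?T) (count_space UNIV)"
        using i by (auto intro!: measurable_compose[OF _ measurable_component_singleton])
    qed
    then show ?thesis unfolding g_def by (intro borel_measurable_divide borel_measurable_sum) auto
  qed
  \<comment> \<open>Decoupled estimator: displacements are read at \<open>x\<close>, hidden points
    and their number at \<open>y\<close>. On the diagonal it is \<open>est_l\<close>; off it the two
    sources of randomness can be integrated in turn.\<close>
  define h where "h x y = (\<Sum>i<n. \<Sum>k<K i y. basis_e j (- X i k y) * basis_e j (- eps i k x)) / of_nat n" for x y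
  have h: "g (\<lambda>(i, k)\<in>J. eps i k x, \<lambda>i\<in>{..<n}. K i y, \<lambda>(i, k)\<in>J. X i k y) = h x y" for x y
    unfolding g_def h_def by (simp add: J_def)
  have est: "est_l n (\<lambda>i. N i x) j = h x x" if x: "x \<in> space M" for x
  proof -
    have "char_sum j (N i x) = (\<Sum>k<K i x. basis_e j (- X i k x) * basis_e j (- eps i k x))" if i: "i < n" for i
    proof -
      have "char_sum j (N i x) = (\<Sum>k<K i x. basis_e j (- frac (X i k x + eps i k x)))"
        unfolding char_sum_def N[OF i x] by (simp add: image_mset.compositionality comp_def sum_unfold_sum_mset)
      then show ?thesis by (simp only: basis_e_minus_frac minus_add_distrib basis_e_add)
    qed
    then show ?thesis unfolding est_l_eq_char_sum h_def by simp
  qed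
  have charX: "(\<Sum>k<K i y. basis_e j (- X i k y)) = char_sum j (hidden i y)"
    and Ksize: "K i y = size (hidden i y)" if "i < n" "y \<in> space M" for i y
    unfolding hid[OF that] char_sum_def
    by (simp_all add: image_mset.compositionality comp_def sum_unfold_sum_mset)
  define R where "R y = (\<Sum>i<n. char_sum j (hidden i y)) / of_nat n - a" for y
  have rv_eps: "random_variable borel (eps i k)" if "i < n" for i k
    using ind_eps that unfolding indep_vars_def J_def by auto
  note ec = expectation_basis_e_centred[OF rv_eps distributed_basis_e[OF M eps f, where j=j, folded \<phi>_def]]
  have \<phi>1: "cmod \<phi> \<le> 1" using ec(4)[of 0] n by auto
  have inner: "(\<integral>\<^sup>+x. ennreal ((cmod (h x y - \<phi> * a))\<^sup>2) \<partial>M) \<le>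
      (\<Sum>i<n. ennreal (real (size (hidden i y)) / (real n)\<^sup>2)) + ennreal ((cmod (R y))\<^sup>2)"
    if y: "y \<in> space M" for y
  proof -
    \<comment> \<open>With \<open>y\<close> frozen this is a fixed finite set, and the displacements
      indexed by it remain independent.\<close>
    define I where "I = Sigma {..<n} (\<lambda>i. {..<K i y})"
    define W where "W = (\<lambda>(i, k) x. basis_e j (- X i k y) / of_nat n * (basis_e j (- eps i k x) - \<phi>))"
    have fin: "finite I" by (auto simp: I_def)
    have "indep_vars (\<lambda>_. borel) (\<lambda>(i, k). eps i k) I"
      by (rule indep_vars_subset[OF ind_eps]) (auto simp: I_def J_def)
    then have "indep_vars (\<lambda>_. borel) (\<lambda>p x. (\<lambda>t. basis_e j (- X (fst p) (snd p) y) / of_nat n * (basis_e j (- t) - \<phi>))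
        ((\<lambda>(i, k). eps i k) p x)) I"
      by (rule indep_vars_compose2) measurable
    also have "(\<lambda>p x. (\<lambda>t. basis_e j (- X (fst p) (snd p) y) / of_nat n * (basis_e j (- t) - \<phi>))
        ((\<lambda>(i, k). eps i k) p x)) = W" by (auto simp: W_def fun_eq_iff)
    finally have indW: "indep_vars (\<lambda>_. borel) W I" .
    have Wsq: "(cmod (W (i, k) x))\<^sup>2 = (cmod (basis_e j (- eps i k x) - \<phi>))\<^sup>2 / (real n)\<^sup>2" for i k x
      by (simp add: W_def norm_mult norm_divide power_mult_distrib power_divide)
    have iW: "integrable M (\<lambda>x. (cmod (W p x))\<^sup>2)" if "p \<in> I" for p
    proof -
      obtain i k where p: "p = (i, k)" "i < n" using \<open>p \<in> I\<close> by (auto simp: I_def)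
      show ?thesis unfolding p Wsq using ec(1)[OF p(2) p(2), of k] by simp
    qed
    have eW: "expectation (\<lambda>x. (cmod (W p x))\<^sup>2) \<le> 1 / (real n)\<^sup>2" if "p \<in> I" for p
    proof -
      obtain i k where p: "p = (i, k)" "i < n" using \<open>p \<in> I\<close> by (auto simp: I_def)
      show ?thesis unfolding p Wsq using ec(3)[OF p(2) p(2), of k] by (simp add: divide_right_mono)
    qed
    have mW: "expectation (W p) = 0" if "p \<in> I" for p
    proof -
      obtain i k where p: "p = (i, k)" "i < n" using \<open>p \<in> I\<close> by (auto simp: I_def)
      show ?thesis unfolding p W_def prod.case integral_mult_right_zero ec(2)[OF p(2) p(2)] by simp
    qed
    \<comment> \<open>Subtracting \<phi> from each displacement character centres the summands; what
      is removed regroups into \<phi> times the error \<open>R y\<close> of the hidden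
      sample.\<close>
    have decomp: "h x y - \<phi> * a = (\<Sum>p\<in>I. W p x) + \<phi> * R y" for x
    proof -
      have "(\<Sum>p\<in>I. W p x) = (\<Sum>i<n. \<Sum>k<K i y. basis_e j (- X i k y) / of_nat n * (basis_e j (- eps i k x) - \<phi>))"
        unfolding I_def W_def by (subst sum.Sigma) (auto intro!: sum.cong)
      also have "\<dots> = h x y - \<phi> * ((\<Sum>i<n. \<Sum>k<K i y. basis_e j (- X i k y)) / of_nat n)"
        by (simp add: h_def sum_divide_distrib sum_distrib_left sum_subtractf diff_divide_distrib algebra_simps)
      also have "(\<Sum>i<n. \<Sum>k<K i y. basis_e j (- X i k y)) = (\<Sum>i<n. char_sum j (hidden i y))"
        using charX y by (intro sum.cong) auto
      finally show ?thesis by (simp add: R_def algebra_simps)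
    qed
    note v = expectation_norm_sq_sum[OF fin indW iW mW, of "\<phi> * R y"]
    have "(\<integral>\<^sup>+x. ennreal ((cmod (h x y - \<phi> * a))\<^sup>2) \<partial>M) =
       ennreal ((\<Sum>p\<in>I. expectation (\<lambda>x. (cmod (W p x))\<^sup>2)) + (cmod (\<phi> * R y))\<^sup>2)"
      unfolding decomp using v by (subst nn_integral_eq_integral) auto
    also have "\<dots> \<le> ennreal ((\<Sum>i<n. real (size (hidden i y)) / (real n)\<^sup>2) + (cmod (R y))\<^sup>2)"
    proof (intro ennreal_leI add_mono)
      have "(\<Sum>p\<in>I. expectation (\<lambda>x. (cmod (W p x))\<^sup>2)) \<le> (\<Sum>p\<in>I. 1 / (real n)\<^sup>2)"
        by (intro sum_mono eW)
      also have "\<dots> = (\<Sum>i<n. real (K i y) / (real n)\<^sup>2)"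
        by (simp add: I_def card_SigmaI sum_divide_distrib)
      also have "\<dots> = (\<Sum>i<n. real (size (hidden i y)) / (real n)\<^sup>2)"
        using Ksize y by (intro sum.cong) auto
      finally show "(\<Sum>p\<in>I. expectation (\<lambda>x. (cmod (W p x))\<^sup>2)) \<le> (\<Sum>i<n. real (size (hidden i y)) / (real n)\<^sup>2)" .
      have "cmod (\<phi> * R y) \<le> cmod (R y)"
        using \<phi>1 by (simp add: norm_mult mult_left_le_one_le)
      then show "(cmod (\<phi> * R y))\<^sup>2 \<le> (cmod (R y))\<^sup>2" by (simp add: power_mono)
    qed
    also have "\<dots> = (\<Sum>i<n. ennreal (real (size (hidden i y)) / (real n)\<^sup>2)) + ennreal ((cmod (R y))\<^sup>2)"
      by (simp add: sum_nonneg sum_ennreal)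
    finally show ?thesis .
  qed
  have pcs: "(\<integral>\<^sup>+x. ennreal (real (size (hidden i x))) \<partial>M) = ennreal \<Lambda>"
    "integrable M (\<lambda>x. (cmod (char_sum j (hidden i x)))\<^sup>2)" "expectation (\<lambda>x. char_sum j (hidden i x)) = a"
    "(\<integral>\<^sup>+x. ennreal ((cmod (char_sum j (hidden i x) - a))\<^sup>2) \<partial>M) \<le> ennreal \<Lambda>" if "i < n" for i
    using poisson_char_sum(1)[OF M pp[OF that] lam] poisson_char_sum(2-4)[OF M pp[OF that] lam, where j=j] unfolding a_def \<Lambda>_def by auto
  have mh: "hidden i \<in> measurable M config_space" if "i < n" for i
    using pp[OF that] by (auto simp: poisson_point_process_def)
  define V where "V i x = (char_sum j (hidden i x) - a) / of_nat n" for i x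
  have indV: "indep_vars (\<lambda>_. borel) V {..<n}" unfolding V_def
    by (rule indep_vars_compose2[OF ind_hid]) measurable
  have rvV: "random_variable borel (V i)" if "i < n" for i
    using indV that by (auto simp: indep_vars_def)
  have Vsq: "(cmod (V i x))\<^sup>2 = (cmod (char_sum j (hidden i x) - a))\<^sup>2 / (real n)\<^sup>2" for i x
    by (simp add: V_def norm_divide power_divide)
  have nV: "(\<integral>\<^sup>+x. ennreal ((cmod (V i x))\<^sup>2) \<partial>M) \<le> ennreal (\<Lambda> / (real n)\<^sup>2)" if i: "i < n" for i
  proof -
    have [measurable]: "random_variable borel (\<lambda>x. char_sum j (hidden i x))"
      by (rule measurable_compose[OF mh[OF i] measurable_char_sum])
    have "(\<integral>\<^sup>+x. ennreal ((cmod (V i x))\<^sup>2) \<partial>M) =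
        (\<integral>\<^sup>+x. ennreal (1 / (real n)\<^sup>2) * ennreal ((cmod (char_sum j (hidden i x) - a))\<^sup>2) \<partial>M)"
      unfolding Vsq by (intro nn_integral_cong) (simp flip: ennreal_mult)
    also have "\<dots> = ennreal (1 / (real n)\<^sup>2) * (\<integral>\<^sup>+x. ennreal ((cmod (char_sum j (hidden i x) - a))\<^sup>2) \<partial>M)"
      by (intro nn_integral_cmult) measurable
    also have "\<dots> \<le> ennreal (1 / (real n)\<^sup>2) * ennreal \<Lambda>"
      by (intro mult_left_mono pcs i) simp
    also have "\<dots> = ennreal (\<Lambda> / (real n)\<^sup>2)" using \<Lambda>0 by (simp flip: ennreal_mult)
    finally show ?thesis .
  qed
  have iV: "integrable M (\<lambda>x. (cmod (V i x))\<^sup>2)" if i: "i < n" for i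
    by (rule integrableI_nonneg) (use nV[OF i] rvV[OF i] in \<open>auto intro: le_less_trans\<close>)
  have eV: "expectation (\<lambda>x. (cmod (V i x))\<^sup>2) \<le> \<Lambda> / (real n)\<^sup>2" if i: "i < n" for i
    using nV[OF i] nn_integral_eq_integral[OF iV[OF i]] \<Lambda>0 by simp
  have mV: "expectation (V i) = 0" if i: "i < n" for i
  proof -
    have "integrable M (\<lambda>x. char_sum j (hidden i x))"
      by (rule integrable_of_norm_sq[OF measurable_compose[OF mh[OF i] measurable_char_sum] pcs(2)[OF i]])
    then show ?thesis using pcs(3)[OF i] by (simp add: V_def[abs_def] prob_space)
  qed
  have RV: "R y = (\<Sum>i<n. V i y) + 0" for y
    using n by (simp add: R_def V_def sum_subtractf sum_divide_distrib diff_divide_distrib)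
  note vR = expectation_norm_sq_sum[OF finite_lessThan indV iV mV, of 0]
  have outer: "(\<integral>\<^sup>+y. ennreal ((cmod (R y))\<^sup>2) \<partial>M) \<le> ennreal (\<Lambda> / real n)"
  proof -
    have "(\<integral>\<^sup>+y. ennreal ((cmod (R y))\<^sup>2) \<partial>M) = ennreal (\<Sum>i<n. expectation (\<lambda>x. (cmod (V i x))\<^sup>2))"
      unfolding RV using vR by (subst nn_integral_eq_integral) auto
    also have "\<dots> \<le> ennreal (\<Sum>i<n. \<Lambda> / (real n)\<^sup>2)"
      using eV by (intro ennreal_leI sum_mono) auto
    also have "\<dots> = ennreal (\<Lambda> / real n)" using n by (simp add: power2_eq_square)
    finally show ?thesis .
  qed
  have size_meas: "(\<lambda>x. real (size (hidden i x))) \<in> borel_measurable M" if "i < n" for i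
  proof -
    have "(\<lambda>x. num_points UNIV (hidden i x)) \<in> measurable M (count_space UNIV)"
      by (rule measurable_compose[OF mh[OF that] measurable_num_points]) simp
    then have "(\<lambda>x. real (num_points UNIV (hidden i x))) \<in> borel_measurable M" by measurable
    then show ?thesis by (simp add: num_points_def)
  qed
  have "(\<integral>\<^sup>+x. ennreal ((cmod (est_l n (\<lambda>i. N i x) j - \<phi> * a))\<^sup>2) \<partial>M) =
    (\<integral>\<^sup>+x. ennreal ((cmod (g (\<lambda>(i, k)\<in>J. eps i k x, \<lambda>i\<in>{..<n}. K i x, \<lambda>(i, k)\<in>J. X i k x) - \<phi> * a))\<^sup>2) \<partial>M)"
    unfolding h using est by (intro nn_integral_cong) simp
  also have "\<dots> = (\<integral>\<^sup>+y. \<integral>\<^sup>+x. ennreal ((cmod (g (\<lambda>(i, k)\<in>J. eps i k x, \<lambda>i\<in>{..<n}. K i y, \<lambda>(i, k)\<in>J. X i k y) - \<phi> * a))\<^sup>2) \<partial>M \<partial>M)"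
    \<comment> \<open>Independence of the displacements from positions and counts together is used
      here: the diagonal integral becomes the decoupled double integral.\<close>
    by (rule indep_rv_nn_integral[OF M indep, where g="\<lambda>z. ennreal ((cmod (g z - \<phi> * a))\<^sup>2)"]) measurable
  also have "\<dots> \<le> (\<integral>\<^sup>+y. (\<Sum>i<n. ennreal (real (size (hidden i y)) / (real n)\<^sup>2)) + ennreal ((cmod (R y))\<^sup>2) \<partial>M)"
    unfolding h by (intro nn_integral_mono inner)
  also have "\<dots> = (\<Sum>i<n. \<integral>\<^sup>+y. ennreal (real (size (hidden i y)) / (real n)\<^sup>2) \<partial>M) + (\<integral>\<^sup>+y. ennreal ((cmod (R y))\<^sup>2) \<partial>M)"
  proof -
    have [measurable]: "random_variable borel R" unfolding RV[abs_def] using rvV by (auto intro!: borel_measurable_sum)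
    have sm: "(\<lambda>y. ennreal (real (size (hidden i y)) / (real n)\<^sup>2)) \<in> borel_measurable M" if "i \<in> {..<n}" for i
    proof -
      have [measurable]: "random_variable borel (\<lambda>y. real (size (hidden i y)))" using size_meas that by simp
      show ?thesis by measurable
    qed
    have [measurable]: "(\<lambda>y. \<Sum>i<n. ennreal (real (size (hidden i y)) / (real n)\<^sup>2)) \<in> borel_measurable M"
      by (rule borel_measurable_sum) (rule sm)
    have "(\<integral>\<^sup>+y. (\<Sum>i<n. ennreal (real (size (hidden i y)) / (real n)\<^sup>2)) + ennreal ((cmod (R y))\<^sup>2) \<partial>M) =
      (\<integral>\<^sup>+y. (\<Sum>i<n. ennreal (real (size (hidden i y)) / (real n)\<^sup>2)) \<partial>M) + (\<integral>\<^sup>+y. ennreal ((cmod (R y))\<^sup>2) \<partial>M)"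
      by (rule nn_integral_add) measurable
    then show ?thesis by (simp only: nn_integral_sum[OF sm])
  qed
  also have "\<dots> \<le> (\<Sum>i<n. ennreal (\<Lambda> / (real n)\<^sup>2)) + ennreal (\<Lambda> / real n)"
  proof (intro add_mono sum_mono outer)
    fix i assume "i \<in> {..<n}"
    then have i: "i < n" by simp
    have "(\<integral>\<^sup>+y. ennreal (real (size (hidden i y)) / (real n)\<^sup>2) \<partial>M) =
       (\<integral>\<^sup>+y. ennreal (1 / (real n)\<^sup>2) * ennreal (real (size (hidden i y))) \<partial>M)"
      by (intro nn_integral_cong) (simp flip: ennreal_mult)
    also have "\<dots> = ennreal (1 / (real n)\<^sup>2) * ennreal \<Lambda>"
      using size_meas[OF i] pcs(1)[OF i] by (subst nn_integral_cmult) auto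
    also have "\<dots> = ennreal (\<Lambda> / (real n)\<^sup>2)" using \<Lambda>0 by (simp flip: ennreal_mult)
    finally show "(\<integral>\<^sup>+y. ennreal (real (size (hidden i y)) / (real n)\<^sup>2) \<partial>M) \<le> ennreal (\<Lambda> / (real n)\<^sup>2)" by simp
  qed
  also have "\<dots> = ennreal ((\<Sum>i<n. \<Lambda> / (real n)\<^sup>2) + \<Lambda> / real n)"
    using \<Lambda>0 by (subst sum_ennreal) (auto simp: sum_nonneg simp flip: ennreal_plus)
  also have "(\<Sum>i<n. \<Lambda> / (real n)\<^sup>2) + \<Lambda> / real n = 2 * \<Lambda> / real n"
    using n by (simp add: power2_eq_square)
  finally show ?thesis unfolding \<Lambda>_def .
qed

section \<open>Thresholded division\<close>

text \<open>Deterministic core of the thresholding. On the event, 1/|p|^2 <= m and the squared error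
  is D/|p|^2; off the event \<open>s\<close> is 0, the error is exactly 1, and |p|^2 < 1/m forces
  |\<phi>|^2 <= 2/m + 2 D. The right-hand sides of the last two claims are the sums of what the two
  cases give: m D and 1, respectively 2 D + 2 m D^2 and 2 D + 2/m.\<close>

lemma inverse_threshold_bounds:
  fixes p \<phi> :: complex and m :: nat
  assumes m: "1 \<le> m"
  defines "D \<equiv> (cmod (p - \<phi>))\<^sup>2" and "s \<equiv> of_bool ((cmod p)\<^sup>2 \<ge> 1 / real m)"
  shows "s / (cmod p)\<^sup>2 * (cmod \<phi>)\<^sup>2 \<le> 2 + 2 * real m * D"
    and "(cmod (\<phi> / p * of_real s - 1))\<^sup>2 \<le> 1 + real m * D"
    and "(cmod (\<phi> / p * of_real s - 1))\<^sup>2 * (cmod \<phi>)\<^sup>2 \<le> 4 * D + 2 * real m * D\<^sup>2 + 2 / real m"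
proof -
  have D0: "0 \<le> D" by (simp add: D_def)
  have m0: "0 < real m" using m by simp
  have phi: "(cmod \<phi>)\<^sup>2 \<le> 2 * (cmod p)\<^sup>2 + 2 * D"
  proof -
    have "(cmod \<phi>)\<^sup>2 \<le> (cmod p + cmod (p - \<phi>))\<^sup>2"
      using norm_triangle_ineq4[of p "p - \<phi>"] by (intro power_mono) auto
    also have "\<dots> \<le> 2 * (cmod p)\<^sup>2 + 2 * D"
      using sum_squares_bound[of "cmod p" "cmod (p - \<phi>)"] by (simp add: D_def power2_sum)
    finally show ?thesis .
  qed
  have "s / (cmod p)\<^sup>2 * (cmod \<phi>)\<^sup>2 \<le> 2 + 2 * real m * D \<and>
    (cmod (\<phi> / p * of_real s - 1))\<^sup>2 \<le> 1 + real m * D \<and>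
    (cmod (\<phi> / p * of_real s - 1))\<^sup>2 * (cmod \<phi>)\<^sup>2 \<le> 4 * D + 2 * real m * D\<^sup>2 + 2 / real m"
  proof (cases "(cmod p)\<^sup>2 \<ge> 1 / real m")
    case True
    then have s: "s = 1" by (simp add: s_def)
    have p2: "0 < (cmod p)\<^sup>2" using True m0 by (smt (verit) divide_pos_pos)
    then have p0: "p \<noteq> 0" by auto
    have inv: "1 / (cmod p)\<^sup>2 \<le> real m"
      using True p2 m0 by (simp add: field_simps)
    have dm: "D / (cmod p)\<^sup>2 \<le> real m * D"
      using mult_right_mono[OF inv D0] by simp
    have 1: "(cmod \<phi>)\<^sup>2 / (cmod p)\<^sup>2 \<le> 2 + 2 * real m * D"
    proof -
      have "(cmod \<phi>)\<^sup>2 / (cmod p)\<^sup>2 \<le> (2 * (cmod p)\<^sup>2 + 2 * D) / (cmod p)\<^sup>2"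
        using phi by (intro divide_right_mono) auto
      also have "\<dots> = 2 + 2 * (D / (cmod p)\<^sup>2)" using p2 by (simp add: add_divide_distrib)
      finally show ?thesis using dm by simp
    qed
    have B: "(cmod (\<phi> / p * of_real s - 1))\<^sup>2 = D / (cmod p)\<^sup>2"
    proof -
      have "\<phi> / p * of_real s - 1 = (\<phi> - p) / p" using p0 s by (simp add: field_simps)
      then show ?thesis by (simp add: D_def norm_divide power_divide norm_minus_commute)
    qed
    \<comment> \<open>Regrouping pairs |\<phi>|^2 with 1/|p|^2, so that the first bound applies;
      bounding D/|p|^2 by m D would lose the smallness in m.\<close>
    have "D / (cmod p)\<^sup>2 * (cmod \<phi>)\<^sup>2 = D * ((cmod \<phi>)\<^sup>2 / (cmod p)\<^sup>2)" by simp
    also have "\<dots> \<le> D * (2 + 2 * real m * D)" using 1 D0 by (rule mult_left_mono)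
    also have "\<dots> \<le> 4 * D + 2 * real m * D\<^sup>2 + 2 / real m"
      using D0 by (simp add: algebra_simps power2_eq_square)
    finally show ?thesis unfolding B using 1 dm D0 m0 by (simp add: s)
  next
    case False
    then have s: "s = 0" by (simp add: s_def)
    have "(cmod \<phi>)\<^sup>2 \<le> 2 * (1 / real m) + 2 * D" using phi False by simp
    moreover have "0 \<le> 2 * real m * D\<^sup>2" by simp
    ultimately have "(cmod \<phi>)\<^sup>2 \<le> 4 * D + 2 * real m * D\<^sup>2 + 2 / real m" using D0 by linarith
    then show ?thesis using D0 m0 by (simp add: s)
  qed
  then show "s / (cmod p)\<^sup>2 * (cmod \<phi>)\<^sup>2 \<le> 2 + 2 * real m * D"
    "(cmod (\<phi> / p * of_real s - 1))\<^sup>2 \<le> 1 + real m * D"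
    "(cmod (\<phi> / p * of_real s - 1))\<^sup>2 * (cmod \<phi>)\<^sup>2 \<le> 4 * D + 2 * real m * D\<^sup>2 + 2 / real m" by auto
qed

section \<open>Risk of a single estimated coefficient\<close>

definition est_coeff :: "nat \<Rightarrow> nat \<Rightarrow> (nat \<Rightarrow> real multiset) \<Rightarrow> (nat \<Rightarrow> real) \<Rightarrow> int \<Rightarrow> complex" where
  "est_coeff n m N Y j = est_l n N j / est_f m Y j * of_bool ((cmod (est_f m Y j))\<^sup>2 \<ge> 1 / real m)"

lemma measurable_est_l: "(\<lambda>N. est_l n N j) \<in> borel_measurable (Pi\<^sub>M {..<n} (\<lambda>_. config_space))"
proof -
  have "(\<lambda>N. char_sum j (N i)) \<in> borel_measurable (Pi\<^sub>M {..<n} (\<lambda>_. config_space))" if "i \<in> {..<n}" for i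
    by (rule measurable_compose[OF measurable_component_singleton[OF that, where M="\<lambda>_. config_space"] measurable_char_sum])
  then show ?thesis unfolding est_l_eq_char_sum
    by (intro borel_measurable_divide borel_measurable_sum borel_measurable_const)
qed

lemma measurable_est_f: "(\<lambda>Y. est_f m Y j) \<in> borel_measurable (Pi\<^sub>M {..<m} (\<lambda>_. borel))"
proof -
  have "(\<lambda>t. basis_e j (- t)) \<in> borel_measurable borel" by measurable
  then show ?thesis unfolding est_f_def
    by (intro borel_measurable_times borel_measurable_sum borel_measurable_const
      measurable_compose[OF measurable_component_singleton, where g="\<lambda>t. basis_e j (- t)"])
qed

text \<open>The error splits into (L - \<phi> a) s/p, whose square is a function of the point
  processes times a function of \<open>Y\<close>, and a (\<phi> s/p - 1), which depends on
  \<open>Y\<close> alone. Independence factorises the mean of the first square. The constant 16 is 2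
  * 2 * 4: the splitting, the risk of \<open>est_l\<close>, and the mean of 2 + 2 m D.\<close>

lemma est_coeff_risk:
  fixes j :: int
  assumes om: "observation_model M n m lam f N Y" and n: "1 \<le> n" and m: "1 \<le> m"
    and lam: "integrable unit_lebesgue lam" "AE t in unit_lebesgue. 0 \<le> lam t"
    and f: "f \<in> borel_measurable unit_lebesgue" "AE t in unit_lebesgue. 0 \<le> f t"
  defines "\<phi> \<equiv> fourier_coeff (\<lambda>t. complex_of_real (f t)) j"
    and "a \<equiv> fourier_coeff (\<lambda>t. complex_of_real (lam t)) j"
    and "\<Lambda> \<equiv> LINT t|unit_lebesgue. lam t"
  assumes \<phi>: "\<phi> \<noteq> 0"
  shows "(\<lambda>x. est_coeff n m (\<lambda>i. N i x) (\<lambda>i. Y i x) j) \<in> borel_measurable M"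
    and "(\<integral>\<^sup>+x. ennreal ((cmod (est_coeff n m (\<lambda>i. N i x) (\<lambda>i. Y i x) j - a))\<^sup>2) \<partial>M)
      \<le> ennreal (16 * \<Lambda> / (real n * (cmod \<phi>)\<^sup>2) + 2 * (cmod a)\<^sup>2 * min 2 (390 / (real m * (cmod \<phi>)\<^sup>2)))"
proof -
  have M: "prob_space M" and Y: "\<And>i. i < m \<Longrightarrow> distributed M unit_lebesgue (Y i) (\<lambda>t. ennreal (f t))"
    and indY: "prob_space.indep_vars M (\<lambda>_. borel) Y {..<m}"
    and indep: "indep_rv M
      (Pi\<^sub>M {..<n} (\<lambda>_. config_space)) (\<lambda>x. \<lambda>i\<in>{..<n}. N i x)
      (Pi\<^sub>M {..<m} (\<lambda>_. borel)) (\<lambda>x. \<lambda>i\<in>{..<m}. Y i x)"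
    using om unfolding observation_model_def by (elim conjE; simp)+
  interpret prob_space M by fact
  have \<Lambda>0: "0 \<le> \<Lambda>" unfolding \<Lambda>_def using lam(2) by (intro integral_nonneg_AE)
  have m0: "0 < real m" using m by simp
  define L where "L x = est_l n (\<lambda>i. N i x) j" for x
  define p where "p x = est_f m (\<lambda>i. Y i x) j" for x
  define s where "s z = (of_bool ((cmod z)\<^sup>2 \<ge> 1 / real m) :: real)" for z :: complex
  \<comment> \<open>The squared modulus of s/p; it is 0 where the denominator is rejected, in
    particular at p = 0.\<close>
  define w where "w z = s z / (cmod z)\<^sup>2" for z
  define D where "D x = (cmod (p x - \<phi>))\<^sup>2" for x
  have L: "est_l n (\<lambda>i\<in>{..<n}. N i x) j = L x" for x by (simp add: L_def est_l_def)
  have p: "est_f m (\<lambda>i\<in>{..<m}. Y i x) j = p x" for x by (simp add: p_def est_f_def)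
  have NM: "(\<lambda>x. \<lambda>i\<in>{..<n}. N i x) \<in> measurable M (Pi\<^sub>M {..<n} (\<lambda>_. config_space))"
    and YM: "(\<lambda>x. \<lambda>i\<in>{..<m}. Y i x) \<in> measurable M (Pi\<^sub>M {..<m} (\<lambda>_. borel))"
    using indep by (auto simp: indep_rv_def)
  have Lm[measurable]: "random_variable borel L"
    using measurable_compose[OF NM measurable_est_l, of j] by (simp add: L)
  have pm[measurable]: "random_variable borel p"
    using measurable_compose[OF YM measurable_est_f, of j] by (simp add: p)
  have sm[measurable]: "s \<in> borel_measurable borel" unfolding s_def by measurable
  have wm[measurable]: "w \<in> borel_measurable borel" unfolding w_def by measurable
  have w0: "0 \<le> w z" for z by (simp add: w_def s_def)
  have ec: "est_coeff n m (\<lambda>i. N i x) (\<lambda>i. Y i x) j = L x / p x * of_real (s (p x))" for x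
    by (simp add: est_coeff_def L_def p_def s_def)
  show "(\<lambda>x. est_coeff n m (\<lambda>i. N i x) (\<lambda>i. Y i x) j) \<in> borel_measurable M"
    unfolding ec by measurable
  note mom = est_f_moments[OF M m Y indY f, where j=j, folded \<phi>_def, folded p_def, folded D_def]
  have D0: "0 \<le> D x" for x by (simp add: D_def)
  have phi2: "0 < (cmod \<phi>)\<^sup>2" using \<phi> by simp
  note thr = inverse_threshold_bounds[OF m, where p="p x" and \<phi>=\<phi> for x, folded D_def s_def]
  have Ew: "(\<integral>\<^sup>+x. ennreal (w (p x)) \<partial>M) \<le> ennreal (4 / (cmod \<phi>)\<^sup>2)"
  proof -
    have "(\<integral>\<^sup>+x. ennreal (w (p x)) \<partial>M) \<le> (\<integral>\<^sup>+x. ennreal ((2 + 2 * real m * D x) / (cmod \<phi>)\<^sup>2) \<partial>M)"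
      using thr(1) phi2 by (intro nn_integral_mono ennreal_leI) (simp add: w_def pos_le_divide_eq)
    also have "\<dots> = ennreal (expectation (\<lambda>x. (2 + 2 * real m * D x) / (cmod \<phi>)\<^sup>2))"
      using mom(1) D0 by (intro nn_integral_eq_integral) auto
    also have "expectation (\<lambda>x. (2 + 2 * real m * D x) / (cmod \<phi>)\<^sup>2) = (2 + 2 * real m * expectation D) / (cmod \<phi>)\<^sup>2"
      using mom(1) by (simp add: prob_space)
    also have "\<dots> \<le> (2 + 2 * real m * (1 / real m)) / (cmod \<phi>)\<^sup>2"
      using mom(3) by (intro divide_right_mono add_left_mono mult_left_mono) auto
    also have "\<dots> = 4 / (cmod \<phi>)\<^sup>2" using m0 by simp
    finally show ?thesis by (simp add: ennreal_leI)
  qed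
  define B where "B x = (cmod (\<phi> / p x * of_real (s (p x)) - 1))\<^sup>2" for x
  have Bm[measurable]: "random_variable borel B" unfolding B_def by measurable
  have EB1: "(\<integral>\<^sup>+x. ennreal (B x) \<partial>M) \<le> ennreal 2"
  proof -
    have "(\<integral>\<^sup>+x. ennreal (B x) \<partial>M) \<le> (\<integral>\<^sup>+x. ennreal (1 + real m * D x) \<partial>M)"
      unfolding B_def using thr(2) by (intro nn_integral_mono ennreal_leI)
    also have "\<dots> = ennreal (expectation (\<lambda>x. 1 + real m * D x))"
      using mom(1) D0 by (intro nn_integral_eq_integral) auto
    also have "expectation (\<lambda>x. 1 + real m * D x) = 1 + real m * expectation D"
      using mom(1) by (simp add: prob_space)
    also have "\<dots> \<le> 1 + real m * (1 / real m)"
      using mom(3) by (intro add_left_mono mult_left_mono) auto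
    also have "\<dots> = 2" using m0 by simp
    finally show ?thesis by (simp only: ennreal_leI)
  qed
  have EB2: "(\<integral>\<^sup>+x. ennreal (B x) \<partial>M) \<le> ennreal (390 / (real m * (cmod \<phi>)\<^sup>2))"
  proof -
    have "(\<integral>\<^sup>+x. ennreal (B x) \<partial>M) \<le> (\<integral>\<^sup>+x. ennreal ((4 * D x + 2 * real m * (D x)\<^sup>2 + 2 / real m) / (cmod \<phi>)\<^sup>2) \<partial>M)"
      unfolding B_def using thr(3) phi2 by (intro nn_integral_mono ennreal_leI) (simp add: pos_le_divide_eq)
    also have "\<dots> = ennreal (expectation (\<lambda>x. (4 * D x + 2 * real m * (D x)\<^sup>2 + 2 / real m) / (cmod \<phi>)\<^sup>2))"
      using mom(1,2) D0 by (intro nn_integral_eq_integral) auto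
    also have "expectation (\<lambda>x. (4 * D x + 2 * real m * (D x)\<^sup>2 + 2 / real m) / (cmod \<phi>)\<^sup>2) =
        (4 * expectation D + 2 * real m * expectation (\<lambda>x. (D x)\<^sup>2) + 2 / real m) / (cmod \<phi>)\<^sup>2"
      using mom(1,2) by (simp add: prob_space)
    \<comment> \<open>Origin of 390: 4 + 2 * 192 + 2, with 192 from the second moment of
      \<open>D\<close>.\<close>
    also have "\<dots> \<le> (4 * (1 / real m) + 2 * real m * (192 / (real m)\<^sup>2) + 2 / real m) / (cmod \<phi>)\<^sup>2"
      using mom(3,4) by (intro divide_right_mono add_mono mult_left_mono) auto
    also have "\<dots> = 390 / (real m * (cmod \<phi>)\<^sup>2)" using m0 by (simp add: field_simps power2_eq_square)
    finally show ?thesis by (simp only: ennreal_leI)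
  qed
  have Eprod: "(\<integral>\<^sup>+x. ennreal ((cmod (L x - \<phi> * a))\<^sup>2) * ennreal (w (p x)) \<partial>M) \<le>
      ennreal (2 * \<Lambda> / real n) * ennreal (4 / (cmod \<phi>)\<^sup>2)"
  proof -
    have "(\<integral>\<^sup>+x. ennreal ((cmod (L x - \<phi> * a))\<^sup>2) * ennreal (w (p x)) \<partial>M) =
        (\<integral>\<^sup>+y. \<integral>\<^sup>+x. ennreal ((cmod (L x - \<phi> * a))\<^sup>2) * ennreal (w (p y)) \<partial>M \<partial>M)"
    proof -
      let ?P = "Pi\<^sub>M {..<n} (\<lambda>_. config_space) \<Otimes>\<^sub>M Pi\<^sub>M {..<m} (\<lambda>_. borel :: real measure)"
      have [measurable]: "(\<lambda>z. est_l n (fst z) j) \<in> borel_measurable ?P" "(\<lambda>z. est_f m (snd z) j) \<in> borel_measurable ?P"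
        by (rule measurable_compose[OF measurable_fst measurable_est_l] measurable_compose[OF measurable_snd measurable_est_f])+
      have "(\<lambda>z. ennreal ((cmod (est_l n (fst z) j - \<phi> * a))\<^sup>2) * ennreal (w (est_f m (snd z) j))) \<in> borel_measurable ?P"
        by measurable
      from indep_rv_nn_integral[OF M indep this] show ?thesis by (simp only: fst_conv snd_conv L p)
    qed
    also have "\<dots> = (\<integral>\<^sup>+y. (\<integral>\<^sup>+x. ennreal ((cmod (L x - \<phi> * a))\<^sup>2) \<partial>M) * ennreal (w (p y)) \<partial>M)"
      by (intro nn_integral_cong nn_integral_multc) measurable
    also have "\<dots> = (\<integral>\<^sup>+x. ennreal ((cmod (L x - \<phi> * a))\<^sup>2) \<partial>M) * (\<integral>\<^sup>+y. ennreal (w (p y)) \<partial>M)"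
      by (intro nn_integral_cmult) measurable
    also have "\<dots> \<le> ennreal (2 * \<Lambda> / real n) * ennreal (4 / (cmod \<phi>)\<^sup>2)"
      using est_l_risk[OF om n lam f, of j] Ew unfolding L_def \<phi>_def a_def \<Lambda>_def
      by (intro mult_mono) auto
    finally show ?thesis .
  qed
  have pw: "ennreal ((cmod (est_coeff n m (\<lambda>i. N i x) (\<lambda>i. Y i x) j - a))\<^sup>2) \<le>
      2 * (ennreal ((cmod (L x - \<phi> * a))\<^sup>2) * ennreal (w (p x))) + ennreal (2 * (cmod a)\<^sup>2) * ennreal (B x)" for x
  proof -
    have par: "(cmod (u + v))\<^sup>2 \<le> 2 * (cmod u)\<^sup>2 + 2 * (cmod v)\<^sup>2" for u v
    proof -
      have "(cmod (u + v))\<^sup>2 \<le> (cmod u + cmod v)\<^sup>2" by (intro power_mono norm_triangle_ineq) simp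
      also have "\<dots> \<le> 2 * (cmod u)\<^sup>2 + 2 * (cmod v)\<^sup>2"
        using sum_squares_bound[of "cmod u" "cmod v"] by (simp add: power2_sum)
      finally show ?thesis .
    qed
    \<comment> \<open>Insert \<phi> a for L: the first term is the sampling error of the numerator,
      the second the relative error of the division.\<close>
    have "est_coeff n m (\<lambda>i. N i x) (\<lambda>i. Y i x) j - a =
        (L x - \<phi> * a) / p x * of_real (s (p x)) + a * (\<phi> / p x * of_real (s (p x)) - 1)"
      unfolding ec by (simp add: diff_divide_distrib algebra_simps)
    then have "(cmod (est_coeff n m (\<lambda>i. N i x) (\<lambda>i. Y i x) j - a))\<^sup>2 \<le>
        2 * (cmod ((L x - \<phi> * a) / p x * of_real (s (p x))))\<^sup>2 + 2 * (cmod (a * (\<phi> / p x * of_real (s (p x)) - 1)))\<^sup>2"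
      using par by simp
    also have "(cmod ((L x - \<phi> * a) / p x * of_real (s (p x))))\<^sup>2 = (cmod (L x - \<phi> * a))\<^sup>2 * w (p x)"
      by (simp add: norm_mult norm_divide power_mult_distrib power_divide w_def s_def)
    also have "(cmod (a * (\<phi> / p x * of_real (s (p x)) - 1)))\<^sup>2 = (cmod a)\<^sup>2 * B x"
      by (simp add: B_def norm_mult power_mult_distrib)
    finally have "ennreal ((cmod (est_coeff n m (\<lambda>i. N i x) (\<lambda>i. Y i x) j - a))\<^sup>2) \<le>
        ennreal (2 * ((cmod (L x - \<phi> * a))\<^sup>2 * w (p x)) + 2 * (cmod a)\<^sup>2 * B x)"
      by (intro ennreal_leI) (simp add: mult.assoc)
    also have "\<dots> = 2 * (ennreal ((cmod (L x - \<phi> * a))\<^sup>2) * ennreal (w (p x))) + ennreal (2 * (cmod a)\<^sup>2) * ennreal (B x)"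
    proof -
      have "0 \<le> B x" by (simp add: B_def)
      then show ?thesis using w0[of "p x"]
        by (subst ennreal_plus) (auto simp: ennreal_mult ennreal_numeral[symmetric] simp del: ennreal_numeral)
    qed
    finally show ?thesis .
  qed
  have "(\<integral>\<^sup>+x. ennreal ((cmod (est_coeff n m (\<lambda>i. N i x) (\<lambda>i. Y i x) j - a))\<^sup>2) \<partial>M) \<le>
    (\<integral>\<^sup>+x. 2 * (ennreal ((cmod (L x - \<phi> * a))\<^sup>2) * ennreal (w (p x))) + ennreal (2 * (cmod a)\<^sup>2) * ennreal (B x) \<partial>M)"
    by (intro nn_integral_mono pw)
  also have "\<dots> = 2 * (\<integral>\<^sup>+x. ennreal ((cmod (L x - \<phi> * a))\<^sup>2) * ennreal (w (p x)) \<partial>M)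
      + ennreal (2 * (cmod a)\<^sup>2) * (\<integral>\<^sup>+x. ennreal (B x) \<partial>M)"
    by (simp add: nn_integral_add nn_integral_cmult)
  also have "\<dots> \<le> 2 * (ennreal (2 * \<Lambda> / real n) * ennreal (4 / (cmod \<phi>)\<^sup>2))
      + ennreal (2 * (cmod a)\<^sup>2) * ennreal (min 2 (390 / (real m * (cmod \<phi>)\<^sup>2)))"
    using EB1 EB2 by (intro add_mono mult_left_mono Eprod) (auto simp: min_def)
  also have "\<dots> = ennreal (2 * (2 * \<Lambda> / real n * (4 / (cmod \<phi>)\<^sup>2)) + 2 * (cmod a)\<^sup>2 * min 2 (390 / (real m * (cmod \<phi>)\<^sup>2)))"
  proof -
    have "2 * (ennreal u * ennreal v) + ennreal b * ennreal c = ennreal (2 * (u * v) + b * c)"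
      if "0 \<le> u" "0 \<le> v" "0 \<le> b" "0 \<le> c" for u v b c
      using that by (simp add: ennreal_plus ennreal_mult)
    then show ?thesis using \<Lambda>0 by simp
  qed
  also have "2 * (2 * \<Lambda> / real n * (4 / (cmod \<phi>)\<^sup>2)) = 16 * \<Lambda> / (real n * (cmod \<phi>)\<^sup>2)" by simp
  finally show "(\<integral>\<^sup>+x. ennreal ((cmod (est_coeff n m (\<lambda>i. N i x) (\<lambda>i. Y i x) j - a))\<^sup>2) \<partial>M)
      \<le> ennreal (16 * \<Lambda> / (real n * (cmod \<phi>)\<^sup>2) + 2 * (cmod a)\<^sup>2 * min 2 (390 / (real m * (cmod \<phi>)\<^sup>2)))" .
qed

text \<open>The empirical coefficient at 0 carries no error and always passes the threshold. This
  matters because \<open>rate_Phi\<close> starts at k = 1 and provides no term for the index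
  0.\<close>

lemma est_f_0: "1 \<le> m \<Longrightarrow> est_f m Y 0 = 1"
  by (simp add: est_f_def)

lemma est_coeff_0: "1 \<le> m \<Longrightarrow> est_coeff n m N Y 0 = est_l n N 0"
  by (simp add: est_coeff_def est_f_0)

section \<open>The weighted risk\<close>

lemma integral_basis_e: "(LINT t|unit_lebesgue. basis_e j t) = of_bool (j = 0)"
proof (cases "j = 0")
  case True
  interpret prob_space unit_lebesgue by (rule prob_space_unit_lebesgue)
  show ?thesis using True prob_space by simp
next
  case False
  define c where "c = 2 * of_real pi * \<i> * of_int j"
  have c0: "c \<noteq> 0" using False by (simp add: c_def)
  define F where "F t = exp (c * of_real t) / c" for t :: real
  have e: "basis_e j t = exp (c * of_real t)" for t by (simp add: basis_e_def c_def)
  have "(LINT t|unit_lebesgue. basis_e j t) = (LINT t|lborel. indicator {0..<1} t *\<^sub>R basis_e j t)"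
    by (rule integral_restrict_space) auto
  \<comment> \<open>The endpoint 1 is a null set; adding it makes the fundamental theorem on a
    closed interval applicable.\<close>
  also have "\<dots> = (LINT t|lborel. indicator {0..1} t *\<^sub>R basis_e j t)"
    using AE_lborel_singleton[of "1 :: real"] by (intro integral_cong_AE) (auto elim!: eventually_mono simp: indicator_def)
  also have "\<dots> = F 1 - F 0"
  proof (rule integral_FTC_Icc)
    show "(F has_vector_derivative basis_e j x) (at x within {0..1})" for x
    proof -
      have "((\<lambda>z. exp (c * z) / c) has_field_derivative exp (c * of_real x)) (at (of_real x))"
        using c0 by (auto intro!: derivative_eq_intros)
      then show ?thesis unfolding F_def e
        by (rule has_vector_derivative_at_within[OF has_vector_derivative_real_field])
    qed
    show "continuous_on {0..1} (basis_e j)" by (rule continuous_on_subset[OF continuous_basis_e]) simp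
  qed simp
  also have "\<dots> = (basis_e j (of_int 1) - basis_e j (of_int 0)) / c"
    unfolding F_def e by (simp add: diff_divide_distrib)
  also have "\<dots> = 0" unfolding basis_e_of_int by simp
  finally show ?thesis using False by simp
qed

section \<open>Splitting the loss into coefficient errors and truncation bias\<close>

lemma est_lambda_eq: "est_lambda n m k N Y t = (\<Sum>i\<in>{- int k..int k}. est_coeff n m N Y i * basis_e i t)"
  by (simp add: est_lambda_def est_coeff_def)

lemma fourier_coeff_est_lambda_diff:
  assumes lam: "integrable unit_lebesgue lam"
  shows "fourier_coeff (\<lambda>t. est_lambda n m k N Y t - complex_of_real (lam t)) j =
    (if j \<in> {- int k..int k} then est_coeff n m N Y j else 0) - fourier_coeff (\<lambda>t. complex_of_real (lam t)) j"
proof -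
  interpret prob_space unit_lebesgue by (rule prob_space_unit_lebesgue)
  let ?K = "{- int k..int k}"
  have b: "basis_e i t * basis_e j (- t) = basis_e (i - j) t" for i t
    by (simp add: basis_e_def algebra_simps flip: exp_add)
  have ib: "integrable unit_lebesgue (basis_e i)" for i
    by (rule integrable_const_bound[where B=1]) (auto intro: borel_unit_lebesgue measurable_basis_e)
  have iS: "integrable unit_lebesgue (\<lambda>t. \<Sum>i\<in>?K. est_coeff n m N Y i * basis_e (i - j) t)"
    by (intro Bochner_Integration.integrable_sum integrable_mult_right ib)
  have "fourier_coeff (\<lambda>t. est_lambda n m k N Y t - complex_of_real (lam t)) j =
      (LINT t|unit_lebesgue. (\<Sum>i\<in>?K. est_coeff n m N Y i * basis_e (i - j) t) - complex_of_real (lam t) * basis_e j (- t))"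
    unfolding fourier_coeff_def est_lambda_eq left_diff_distrib sum_distrib_right mult.assoc b ..
  also have "\<dots> = (\<Sum>i\<in>?K. LINT t|unit_lebesgue. est_coeff n m N Y i * basis_e (i - j) t)
      - fourier_coeff (\<lambda>t. complex_of_real (lam t)) j"
    unfolding fourier_coeff_def
    by (subst Bochner_Integration.integral_diff[OF iS fourier_coeff_of_real_integrable[OF lam]],
      subst Bochner_Integration.integral_sum) (intro integrable_mult_right ib refl)+
  also have "(\<Sum>i\<in>?K. LINT t|unit_lebesgue. est_coeff n m N Y i * basis_e (i - j) t) =
      (\<Sum>i\<in>?K. if j = i then est_coeff n m N Y i else 0)"
    by (intro sum.cong refl) (auto simp: integral_basis_e)
  also have "\<dots> = (if j \<in> ?K then est_coeff n m N Y j else 0)"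
    by (rule sum.delta') simp
  finally show ?thesis .
qed

text \<open>The second sum is the truncation bias and is not random. In \<open>ennreal\<close> every
  family is summable, so the index set can be split at once.\<close>

lemma wnorm2_est_lambda_diff:
  assumes lam: "integrable unit_lebesgue lam"
  defines "a \<equiv> fourier_coeff (\<lambda>t. complex_of_real (lam t))"
  shows "wnorm2 \<omega> (\<lambda>t. est_lambda n m k N Y t - complex_of_real (lam t)) =
    (\<Sum>j\<in>{- int k..int k}. ennreal (\<omega> j * (cmod (est_coeff n m N Y j - a j))\<^sup>2)) +
    (\<Sum>\<^sub>\<infinity>j\<in>- {- int k..int k}. ennreal (\<omega> j * (cmod (a j))\<^sup>2))"
proof -
  let ?K = "{- int k..int k}"
  have "wnorm2 \<omega> (\<lambda>t. est_lambda n m k N Y t - complex_of_real (lam t)) =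
    (\<Sum>\<^sub>\<infinity>j\<in>?K \<union> - ?K. ennreal (\<omega> j * (cmod ((if j \<in> ?K then est_coeff n m N Y j else 0) - a j))\<^sup>2))"
    unfolding wnorm2_def fourier_coeff_est_lambda_diff[OF lam] a_def by simp
  also have "\<dots> = (\<Sum>\<^sub>\<infinity>j\<in>?K. ennreal (\<omega> j * (cmod ((if j \<in> ?K then est_coeff n m N Y j else 0) - a j))\<^sup>2)) +
     (\<Sum>\<^sub>\<infinity>j\<in>- ?K. ennreal (\<omega> j * (cmod ((if j \<in> ?K then est_coeff n m N Y j else 0) - a j))\<^sup>2))"
    by (intro infsum_Un_disjoint nonneg_summable_on_complete) auto
  also have "(\<Sum>\<^sub>\<infinity>j\<in>?K. ennreal (\<omega> j * (cmod ((if j \<in> ?K then est_coeff n m N Y j else 0) - a j))\<^sup>2)) =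
      (\<Sum>j\<in>?K. ennreal (\<omega> j * (cmod (est_coeff n m N Y j - a j))\<^sup>2))"
    by (subst infsum_finite) (auto intro: sum.cong)
  also have "(\<Sum>\<^sub>\<infinity>j\<in>- ?K. ennreal (\<omega> j * (cmod ((if j \<in> ?K then est_coeff n m N Y j else 0) - a j))\<^sup>2)) =
      (\<Sum>\<^sub>\<infinity>j\<in>- ?K. ennreal (\<omega> j * (cmod (a j))\<^sup>2))"
    by (intro infsum_cong) auto
  finally show ?thesis .
qed

lemma L2_unit_integrable:
  fixes g :: "real \<Rightarrow> real"
  assumes "g \<in> L2_unit"
  shows "integrable unit_lebesgue g"
proof -
  interpret prob_space unit_lebesgue by (rule prob_space_unit_lebesgue)
  have "g \<in> borel_measurable unit_lebesgue" "integrable unit_lebesgue (\<lambda>t. (g t)\<^sup>2)"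
    using assms by (simp_all add: L2_unit_def)
  then show ?thesis by (rule square_integrable_imp_integrable)
qed

text \<open>Passage from the extended-valued norm in the class to real inequalities on finite index
  sets, the form in which membership in the class is used.\<close>

lemma finite_sum_wnorm2_le:
  assumes w: "\<And>j. 0 \<le> w j" and le: "wnorm2 w g \<le> ennreal r" and r: "0 \<le> r" and F: "finite F"
  shows "(\<Sum>j\<in>F. w j * (cmod (fourier_coeff g j))\<^sup>2) \<le> r"
proof -
  have "ennreal (\<Sum>j\<in>F. w j * (cmod (fourier_coeff g j))\<^sup>2) = (\<Sum>j\<in>F. ennreal (w j * (cmod (fourier_coeff g j))\<^sup>2))"
    using w by (subst sum_ennreal) auto
  also have "\<dots> \<le> wnorm2 w g"
    unfolding wnorm2_def using F by (subst nonneg_infsum_complete) (auto intro: SUP_upper)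
  also note le
  finally show ?thesis using r by simp
qed

lemma symmetric_seq_nat_abs: "symmetric_seq a \<Longrightarrow> a (int (nat \<bar>j\<bar>)) = a j"
  by (cases "0 \<le> j") (auto simp: symmetric_seq_def)

text \<open>The three parts of \<open>C\<close> belong to the truncation bias, bounded by r \<Psi>,
  to the variance, and to the division error. In the latter two, \<open>d\<close> appears because
  |\<phi>|^2 is at least \<alpha>/d.\<close>

lemma est_lambda_risk:
  fixes \<gamma> \<alpha> \<omega> :: "int \<Rightarrow> real" and r d :: real
  assumes r: "r > 0" and d: "d \<ge> 1"
    and \<gamma>0: "\<And>j. \<gamma> j > 0" and \<alpha>0: "\<And>j. \<alpha> j > 0" and \<omega>0: "\<And>j. \<omega> j > 0"
    and sym: "symmetric_seq \<gamma>" "symmetric_seq \<alpha>" "symmetric_seq \<omega>"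
    and \<gamma>1: "\<gamma> 0 = 1" and \<omega>1: "\<omega> 0 = 1" and \<alpha>1: "\<alpha> 0 = 1"
    and dec: "decseq (\<lambda>k :: nat. \<omega> (int k) / \<gamma> (int k))"
    and n: "1 \<le> n" and m: "1 \<le> m" and k: "is_arg_min (rate_objective \<omega> \<gamma> \<alpha> n) (\<lambda>_. True) k"
    and om: "observation_model M n m lam f N Y"
    and lamC: "lam \<in> Lambda_class \<gamma> r" and fC: "f \<in> F_class \<alpha> d"
  defines "C \<equiv> r + 16 * d * sqrt r + 780 * d * r"
  shows "(\<integral>\<^sup>+x. wnorm2 \<omega> (\<lambda>t. est_lambda n m k (\<lambda>i. N i x) (\<lambda>i. Y i x) t - complex_of_real (lam t)) \<partial>M)
    \<le> ennreal (C * (rate_Psi \<omega> \<gamma> \<alpha> n + rate_Phi \<omega> \<gamma> \<alpha> m))"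
proof -
  have d0: "0 < d" using d by simp
  have ratio_sym: "\<omega> j / \<gamma> j = \<omega> (int (nat \<bar>j\<bar>)) / \<gamma> (int (nat \<bar>j\<bar>))" for j
    using sym by (simp only: symmetric_seq_nat_abs)
  have M: "prob_space M" using om by (simp add: observation_model_def)
  interpret prob_space M by fact
  define a where "a = fourier_coeff (\<lambda>t. complex_of_real (lam t))"
  define \<phi> where "\<phi> = fourier_coeff (\<lambda>t. complex_of_real (f t))"
  define \<Lambda> where "\<Lambda> = (LINT t|unit_lebesgue. lam t)"
  define \<Psi> where "\<Psi> = rate_Psi \<omega> \<gamma> \<alpha> n"
  define \<Phi> where "\<Phi> = rate_Phi \<omega> \<gamma> \<alpha> m"
  have n0: "0 < real n" and m0: "0 < real m" using n m by auto
  have lam: "integrable unit_lebesgue lam" "AE t in unit_lebesgue. 0 \<le> lam t"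
    using lamC L2_unit_integrable by (auto simp: Lambda_class_def)
  have f: "f \<in> borel_measurable unit_lebesgue" "AE t in unit_lebesgue. 0 \<le> f t" and \<phi>0: "\<phi> 0 = 1"
    using fC by (auto simp: F_class_def L2_unit_def \<phi>_def)
  have \<phi>j: "\<alpha> j / d \<le> (cmod (\<phi> j))\<^sup>2" for j
  proof -
    have "1 / d \<le> (cmod (\<phi> j))\<^sup>2 / \<alpha> j" using fC by (auto simp: F_class_def \<phi>_def)
    then show ?thesis using \<alpha>0[of j] d0 by (simp add: field_simps)
  qed
  have \<phi>pos: "0 < (cmod (\<phi> j))\<^sup>2" for j
    using \<phi>j[of j] \<alpha>0[of j] d0 by (meson divide_pos_pos less_le_trans)
  have asum: "(\<Sum>j\<in>F. \<gamma> j * (cmod (a j))\<^sup>2) \<le> r" if "finite F" for F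
    unfolding a_def using lamC \<gamma>0 r that by (intro finite_sum_wnorm2_le) (auto simp: Lambda_class_def less_imp_le)
  have \<Lambda>0: "0 \<le> \<Lambda>" unfolding \<Lambda>_def using lam(2) by (intro integral_nonneg_AE)
  have \<Lambda>r: "\<Lambda> \<le> sqrt r"
  proof -
    \<comment> \<open>The total intensity is the coefficient of index 0, so the single term at 0 of
      the class constraint bounds its square by r.\<close>
    have "a 0 = complex_of_real \<Lambda>" by (simp add: a_def fourier_coeff_def \<Lambda>_def)
    then have "\<Lambda>\<^sup>2 \<le> r" using asum[of "{0}"] \<gamma>1 by simp
    then show ?thesis by (rule real_le_rsqrt)
  qed
  have \<Psi>: "rate_objective \<omega> \<gamma> \<alpha> n k \<le> \<Psi>"
    unfolding \<Psi>_def rate_Psi_def using k by (intro cINF_greatest) (auto simp: is_arg_min_linorder)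
  then have \<Psi>1: "\<omega> (int k) / \<gamma> (int k) \<le> \<Psi>" and \<Psi>2: "(\<Sum>j\<in>{- int k..int k}. \<omega> j / (real n * \<alpha> j)) \<le> \<Psi>"
    by (simp_all add: rate_objective_def)
  have \<Phi>1: "\<omega> j / \<gamma> j * min 1 (1 / (real m * \<alpha> j)) \<le> \<Phi>" if "j \<noteq> 0" for j
  proof -
    \<comment> \<open>A real \<open>SUP\<close> dominates its family only if the family is bounded
      above. Here 1 is a bound, as the ratios do not increase from their value 1 at 0.\<close>
    have "\<omega> (int i) / \<gamma> (int i) * min 1 (1 / (real m * \<alpha> (int i))) \<le> 1" for i
    proof -
      have "\<omega> (int i) / \<gamma> (int i) \<le> \<omega> (int 0) / \<gamma> (int 0)" using decseqD[OF dec, of 0 i] by simp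
      then have "\<omega> (int i) / \<gamma> (int i) \<le> 1" using \<gamma>1 \<omega>1 by simp
      moreover have "0 \<le> \<omega> (int i) / \<gamma> (int i)" using \<omega>0[of "int i"] \<gamma>0[of "int i"] by simp
      moreover have "0 \<le> min 1 (1 / (real m * \<alpha> (int i)))" using \<alpha>0[of "int i"] m0 by simp
      ultimately show ?thesis by (intro mult_le_one) auto
    qed
    then have "bdd_above ((\<lambda>i. \<omega> (int i) / \<gamma> (int i) * min 1 (1 / (real m * \<alpha> (int i)))) ` {1..})"
      by (intro bdd_aboveI2)
    moreover have "nat \<bar>j\<bar> \<in> {1..}" using that by auto
    ultimately have "\<omega> (int (nat \<bar>j\<bar>)) / \<gamma> (int (nat \<bar>j\<bar>)) * min 1 (1 / (real m * \<alpha> (int (nat \<bar>j\<bar>)))) \<le> \<Phi>"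
      unfolding \<Phi>_def rate_Phi_def by (intro cSUP_upper)
    then show ?thesis using sym by (simp only: symmetric_seq_nat_abs)
  qed
  have \<Psi>0: "0 \<le> \<Psi>" using \<Psi>1 \<omega>0[of "int k"] \<gamma>0[of "int k"] by (meson divide_nonneg_nonneg less_imp_le order_trans)
  have \<Phi>0: "0 \<le> \<Phi>"
  proof -
    have "0 \<le> \<omega> 1 / \<gamma> 1 * min 1 (1 / (real m * \<alpha> 1))" using \<omega>0[of 1] \<gamma>0[of 1] \<alpha>0[of 1] m0 by simp
    with \<Phi>1[of 1] show ?thesis by simp
  qed
  define E where "E x j = est_coeff n m (\<lambda>i. N i x) (\<lambda>i. Y i x) j" for x j
  note risk = est_coeff_risk[OF om n m lam f, folded a_def \<phi>_def \<Lambda>_def]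
  have \<phi>ne: "\<phi> j \<noteq> 0" for j using \<phi>pos[of j] by auto
  have Em[measurable]: "(\<lambda>x. E x j) \<in> borel_measurable M" for j
    unfolding E_def by (rule risk(1)[OF \<phi>ne])
  \<comment> \<open>The factor 780 is 2 * 390. At 0 only the variance term remains, since no
    division error occurs there.\<close>
  define b where "b j = 16 * \<Lambda> * d / (real n * \<alpha> j) +
      (if j = 0 then 0 else 780 * d * (cmod (a j))\<^sup>2 * min 1 (1 / (real m * \<alpha> j)))" for j
  have b0: "0 \<le> b j" for j
    unfolding b_def using \<Lambda>0 d0 \<alpha>0[of j] n0 m0 by (auto intro!: add_nonneg_nonneg mult_nonneg_nonneg)
  have Erisk: "(\<integral>\<^sup>+x. ennreal ((cmod (E x j - a j))\<^sup>2) \<partial>M) \<le> ennreal (b j)" for j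
  proof (cases "j = 0")
    case True
    have "(\<integral>\<^sup>+x. ennreal ((cmod (E x j - a j))\<^sup>2) \<partial>M) \<le> ennreal (2 * \<Lambda> / real n)"
      using est_l_risk[OF om n lam f, of 0] unfolding a_def[symmetric] \<phi>_def[symmetric] \<Lambda>_def[symmetric] \<phi>0
      by (simp add: E_def True est_coeff_0[OF m])
    also have "2 * \<Lambda> / real n \<le> b j"
    proof -
      have "2 * \<Lambda> \<le> 16 * \<Lambda> * d" using \<Lambda>0 d mult_left_mono[of 1 d "16 * \<Lambda>"] by simp
      then show ?thesis using n0 \<alpha>1 by (simp add: b_def True divide_right_mono)
    qed
    finally show ?thesis by (simp add: ennreal_leI)
  next
    case False
    have "16 * \<Lambda> / (real n * (cmod (\<phi> j))\<^sup>2) \<le> 16 * \<Lambda> / (real n * (\<alpha> j / d))"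
      using \<Lambda>0 n0 \<phi>j[of j] \<alpha>0[of j] d0 by (intro divide_left_mono mult_left_mono mult_pos_pos \<phi>pos) auto
    also have "\<dots> = 16 * \<Lambda> * d / (real n * \<alpha> j)" by simp
    finally have 1: "16 * \<Lambda> / (real n * (cmod (\<phi> j))\<^sup>2) \<le> 16 * \<Lambda> * d / (real n * \<alpha> j)" .
    have "390 / (real m * (cmod (\<phi> j))\<^sup>2) \<le> 390 / (real m * (\<alpha> j / d))"
      using m0 \<phi>j[of j] \<alpha>0[of j] d0 by (intro divide_left_mono mult_left_mono mult_pos_pos \<phi>pos) auto
    also have "\<dots> = 390 * d * (1 / (real m * \<alpha> j))" by simp
    \<comment> \<open>The constant 2 is enlarged to 390 d so that a common factor can be pulled out
      of the minimum.\<close>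
    finally have "min 2 (390 / (real m * (cmod (\<phi> j))\<^sup>2)) \<le> min (390 * d * 1) (390 * d * (1 / (real m * \<alpha> j)))"
      using d by (intro min.mono) auto
    also have "\<dots> = 390 * d * min 1 (1 / (real m * \<alpha> j))"
      using d0 by (subst min_mult_distrib_left) auto
    finally have "2 * (cmod (a j))\<^sup>2 * min 2 (390 / (real m * (cmod (\<phi> j))\<^sup>2)) \<le>
        2 * (cmod (a j))\<^sup>2 * (390 * d * min 1 (1 / (real m * \<alpha> j)))"
      by (intro mult_left_mono) auto
    also have "\<dots> = 780 * d * (cmod (a j))\<^sup>2 * min 1 (1 / (real m * \<alpha> j))" by simp
    finally have 2: "2 * (cmod (a j))\<^sup>2 * min 2 (390 / (real m * (cmod (\<phi> j))\<^sup>2)) \<le>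
        780 * d * (cmod (a j))\<^sup>2 * min 1 (1 / (real m * \<alpha> j))" .
    have "(\<integral>\<^sup>+x. ennreal ((cmod (E x j - a j))\<^sup>2) \<partial>M) \<le>
      ennreal (16 * \<Lambda> / (real n * (cmod (\<phi> j))\<^sup>2) + 2 * (cmod (a j))\<^sup>2 * min 2 (390 / (real m * (cmod (\<phi> j))\<^sup>2)))"
      unfolding E_def by (rule risk(2)[OF \<phi>ne])
    also have "\<dots> \<le> ennreal (b j)"
      unfolding b_def using False 1 2 by (intro ennreal_leI) auto
    finally show ?thesis .
  qed
  let ?K = "{- int k..int k}"
  define tail where "tail = (\<Sum>\<^sub>\<infinity>j\<in>- ?K. ennreal (\<omega> j * (cmod (a j))\<^sup>2))"
  have tail: "tail \<le> ennreal (r * \<Psi>)"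
    unfolding tail_def
  proof (rule infsum_le_finite_sums)
    fix F assume F: "finite F" "F \<subseteq> - ?K"
    \<comment> \<open>Beyond the cut-off the ratio is at most its value at \<open>k\<close>, which
      is one of the two quantities in the minimised maximum and so at most \<Psi>.\<close>
    have "(\<Sum>j\<in>F. \<omega> j * (cmod (a j))\<^sup>2) \<le> (\<Sum>j\<in>F. \<Psi> * (\<gamma> j * (cmod (a j))\<^sup>2))"
    proof (rule sum_mono)
      fix j assume "j \<in> F"
      with F have "k \<le> nat \<bar>j\<bar>" by (cases "0 \<le> j") auto
      then have "\<omega> j / \<gamma> j \<le> \<Psi>"
        using decseqD[OF dec, of k "nat \<bar>j\<bar>"] ratio_sym[of j] \<Psi>1 by simp
      then have "\<omega> j \<le> \<Psi> * \<gamma> j" using \<gamma>0[of j] by (simp add: field_simps)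
      then show "\<omega> j * (cmod (a j))\<^sup>2 \<le> \<Psi> * (\<gamma> j * (cmod (a j))\<^sup>2)"
        by (simp add: mult_right_mono flip: mult.assoc)
    qed
    also have "\<dots> \<le> \<Psi> * r"
      unfolding sum_distrib_left[symmetric] using asum[OF F(1)] \<Psi>0 by (rule mult_left_mono)
    finally have "ennreal (\<Sum>j\<in>F. \<omega> j * (cmod (a j))\<^sup>2) \<le> ennreal (r * \<Psi>)"
      by (intro ennreal_leI) (simp add: mult.commute)
    then show "(\<Sum>j\<in>F. ennreal (\<omega> j * (cmod (a j))\<^sup>2)) \<le> ennreal (r * \<Psi>)"
      using \<omega>0 by (subst sum_ennreal) (auto simp: less_imp_le)
  qed (simp add: nonneg_summable_on_complete)
  have main: "(\<Sum>j\<in>?K. \<omega> j * b j) \<le> 16 * d * sqrt r * \<Psi> + 780 * d * r * \<Phi>"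
  proof -
    have "(\<Sum>j\<in>?K. \<omega> j * b j) \<le>
      (\<Sum>j\<in>?K. 16 * \<Lambda> * d * (\<omega> j / (real n * \<alpha> j)) + 780 * d * \<Phi> * (\<gamma> j * (cmod (a j))\<^sup>2))"
    proof (rule sum_mono)
      fix j assume "j \<in> ?K"
      have "\<omega> j * (if j = 0 then 0 else 780 * d * (cmod (a j))\<^sup>2 * min 1 (1 / (real m * \<alpha> j)))
          \<le> 780 * d * \<Phi> * (\<gamma> j * (cmod (a j))\<^sup>2)"
      proof (cases "j = 0")
        case True
        then show ?thesis using d0 \<Phi>0 \<gamma>1 by simp
      next
        case False
        have "\<omega> j * (780 * d * (cmod (a j))\<^sup>2 * min 1 (1 / (real m * \<alpha> j))) =
          780 * d * (\<gamma> j * (cmod (a j))\<^sup>2) * (\<omega> j / \<gamma> j * min 1 (1 / (real m * \<alpha> j)))"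
          using \<gamma>0[of j] by simp
        also have "\<dots> \<le> 780 * d * (\<gamma> j * (cmod (a j))\<^sup>2) * \<Phi>"
          using d0 \<gamma>0[of j] by (intro mult_left_mono \<Phi>1 False) auto
        finally show ?thesis using False by (simp add: mult_ac)
      qed
      then show "\<omega> j * b j \<le> 16 * \<Lambda> * d * (\<omega> j / (real n * \<alpha> j)) + 780 * d * \<Phi> * (\<gamma> j * (cmod (a j))\<^sup>2)"
        unfolding b_def ring_distribs by (simp add: mult_ac)
    qed
    also have "\<dots> = 16 * \<Lambda> * d * (\<Sum>j\<in>?K. \<omega> j / (real n * \<alpha> j)) + 780 * d * \<Phi> * (\<Sum>j\<in>?K. \<gamma> j * (cmod (a j))\<^sup>2)"
      by (simp only: sum.distrib sum_distrib_left)
    also have "\<dots> \<le> 16 * sqrt r * d * \<Psi> + 780 * d * \<Phi> * r"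
      using \<Lambda>0 \<Lambda>r d0 \<Phi>0 \<Psi>0 r \<alpha>0 \<gamma>0 \<omega>0
      by (intro add_mono mult_mono \<Psi>2 asum) (auto intro!: sum_nonneg simp: less_imp_le)
    finally show ?thesis by (simp add: mult_ac)
  qed
  have "(\<integral>\<^sup>+x. wnorm2 \<omega> (\<lambda>t. est_lambda n m k (\<lambda>i. N i x) (\<lambda>i. Y i x) t - complex_of_real (lam t)) \<partial>M) =
    (\<integral>\<^sup>+x. (\<Sum>j\<in>?K. ennreal (\<omega> j) * ennreal ((cmod (E x j - a j))\<^sup>2)) + tail \<partial>M)"
    unfolding wnorm2_est_lambda_diff[OF lam(1)] tail_def E_def a_def
    using \<omega>0 by (simp add: ennreal_mult less_imp_le)
  also have "\<dots> = (\<Sum>j\<in>?K. ennreal (\<omega> j) * (\<integral>\<^sup>+x. ennreal ((cmod (E x j - a j))\<^sup>2) \<partial>M)) + tail"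
    by (simp add: nn_integral_add nn_integral_sum nn_integral_cmult emeasure_space_1)
  also have "\<dots> \<le> (\<Sum>j\<in>?K. ennreal (\<omega> j) * ennreal (b j)) + ennreal (r * \<Psi>)"
    by (intro add_mono sum_mono mult_left_mono Erisk tail) simp
  also have "\<dots> = ennreal ((\<Sum>j\<in>?K. \<omega> j * b j) + r * \<Psi>)"
  proof -
    have \<omega>b: "0 \<le> \<omega> j * b j" for j using \<omega>0[of j] b0[of j] by simp
    have "(\<Sum>j\<in>?K. ennreal (\<omega> j) * ennreal (b j)) = (\<Sum>j\<in>?K. ennreal (\<omega> j * b j))"
      using \<omega>0 b0 by (intro sum.cong refl) (simp add: ennreal_mult less_imp_le)
    also have "\<dots> = ennreal (\<Sum>j\<in>?K. \<omega> j * b j)" by (rule sum_ennreal) (rule \<omega>b)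
    finally show ?thesis using \<omega>b r \<Psi>0 by (simp add: ennreal_plus sum_nonneg)
  qed
  also have "\<dots> \<le> ennreal (C * (\<Psi> + \<Phi>))"
  proof (rule ennreal_leI)
    \<comment> \<open>Multiplying the sum of the three constants by the sum of the two rates
      produces exactly these terms in excess of the bound.\<close>
    have "0 \<le> 780 * d * r * \<Psi>" "0 \<le> r * \<Phi>" "0 \<le> 16 * d * sqrt r * \<Phi>"
      using d0 r \<Psi>0 \<Phi>0 by auto
    then show "(\<Sum>j\<in>?K. \<omega> j * b j) + r * \<Psi> \<le> C * (\<Psi> + \<Phi>)"
      using main by (simp add: C_def algebra_simps)
  qed
  finally show ?thesis unfolding \<Psi>_def \<Phi>_def .
qed

theorem theorem3p5:
  fixes \<gamma> \<alpha> \<omega> :: "int \<Rightarrow> real" and r d :: real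
  assumes "r > 0" and "d \<ge> 1"
    and "\<forall>j. \<gamma> j > 0" and "\<forall>j. \<alpha> j > 0" and "\<forall>j. \<omega> j > 0"
    and "symmetric_seq \<gamma>" and "symmetric_seq \<alpha>" and "symmetric_seq \<omega>"
    and "\<gamma> 0 = 1" and "\<omega> 0 = 1" and "\<alpha> 0 = 1"
    and "\<forall>j. \<gamma> j \<ge> 1"
    and "decseq (\<lambda>k :: nat. \<omega> (int k) / \<gamma> (int k))"
    and "decseq (\<lambda>k :: nat. \<alpha> (int k))"
    and "\<alpha> summable_on UNIV"
  shows "\<exists>C > 0. \<forall>n \<ge> 1. \<forall>m \<ge> 1. \<forall>kstar :: nat.
    is_arg_min (rate_objective \<omega> \<gamma> \<alpha> n) (\<lambda>_. True) kstar \<longrightarrow>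
    (\<forall>(P :: (real \<Rightarrow> real) \<Rightarrow> (real \<Rightarrow> real) \<Rightarrow> 'a measure)
       (N :: nat \<Rightarrow> 'a \<Rightarrow> real multiset) (Y :: nat \<Rightarrow> 'a \<Rightarrow> real).
      (\<forall>lam \<in> Lambda_class \<gamma> r. \<forall>f \<in> F_class \<alpha> d. observation_model (P lam f) n m lam f N Y) \<longrightarrow>
      (SUP lam \<in> Lambda_class \<gamma> r. SUP f \<in> F_class \<alpha> d.
         \<integral>\<^sup>+ x. wnorm2 \<omega> (\<lambda>t. est_lambda n m kstar (\<lambda>i. N i x) (\<lambda>i. Y i x) t - complex_of_real (lam t))
           \<partial>(P lam f))
      \<le> ennreal (C * (rate_Psi \<omega> \<gamma> \<alpha> n + rate_Phi \<omega> \<gamma> \<alpha> m)))"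
proof -
  \<comment> \<open>This value depends on \<open>r\<close> and \<open>d\<close> only, so it is fixed
    before the sample sizes, the cut-off and the probability measures are chosen.\<close>
  define C where "C = r + 16 * d * sqrt r + 780 * d * r"
  have C0: "0 < C" using assms(1,2) by (auto simp: C_def intro!: add_pos_nonneg)
  note bound = est_lambda_risk[OF assms(1,2) assms(3-5)[rule_format] assms(6-11,13), folded C_def]
  show ?thesis
  proof (rule exI[of _ C], rule conjI[OF C0], intro allI impI)
    fix n m k :: nat and P :: "(real \<Rightarrow> real) \<Rightarrow> (real \<Rightarrow> real) \<Rightarrow> 'a measure"
      and N :: "nat \<Rightarrow> 'a \<Rightarrow> real multiset" and Y :: "nat \<Rightarrow> 'a \<Rightarrow> real"
    assume *: "1 \<le> n" "1 \<le> m" "is_arg_min (rate_objective \<omega> \<gamma> \<alpha> n) (\<lambda>_. True) k"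
      and obs: "\<forall>lam \<in> Lambda_class \<gamma> r. \<forall>f \<in> F_class \<alpha> d. observation_model (P lam f) n m lam f N Y"
    show "(SUP lam \<in> Lambda_class \<gamma> r. SUP f \<in> F_class \<alpha> d.
         \<integral>\<^sup>+ x. wnorm2 \<omega> (\<lambda>t. est_lambda n m k (\<lambda>i. N i x) (\<lambda>i. Y i x) t - complex_of_real (lam t))
           \<partial>(P lam f))
      \<le> ennreal (C * (rate_Psi \<omega> \<gamma> \<alpha> n + rate_Phi \<omega> \<gamma> \<alpha> m))"
    proof (rule SUP_least, rule SUP_least)
      fix lam f assume "lam \<in> Lambda_class \<gamma> r" "f \<in> F_class \<alpha> d"
      then show "(\<integral>\<^sup>+ x. wnorm2 \<omega> (\<lambda>t. est_lambda n m k (\<lambda>i. N i x) (\<lambda>i. Y i x) t - complex_of_real (lam t))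
           \<partial>(P lam f)) \<le> ennreal (C * (rate_Psi \<omega> \<gamma> \<alpha> n + rate_Phi \<omega> \<gamma> \<alpha> m))"
        using obs by (intro bound[OF *]) auto
    qed
  qed
qed

end
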